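(* Let $K$ be a closed subgroup of the orthogonal group $O(n)$, let $G=\mathbb{R}^n\cdot K$ be the semidirect product, and let $K_{\mathbb{C}}\subset O(n;\mathbb{C})$ be the complexification of $K$. Let $\xi,\xi'\in\mathbb{C}^n$. Then the following conditions are equivalent. 1. The $(G,K)$-spherical functions $\varphi_\xi^K$ and $\varphi_{\xi'}^K$ are equal: $\varphi_\xi^K=\varphi_{\xi'}^K$. 2. The orbit closure $\overline{K_{\mathbb{C}}(\xi)}$ meets the orbit closure $\overline{K_{\mathbb{C}}(\xi')}$. 3. If $p$ is a $K_{\mathbb{C}}$-invariant polynomial on $\mathbb{C}^n$ then $p(\xi)=p(\xi')$. 4. The vectors $\xi,\xi'\in\mathbb{C}^n$ have the same image under the projection $\pi:\mathbb{C}^n\to\mathbb{C}^n/\!/K_{\mathbb{C}}$ to the categorical quotient.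
   Context: $b$ is the $\mathbb{C}$-bilinear form on $\mathbb{C}^n$ extending the standard inner product of $\mathbb{R}^n$; $K\subset O(n)$ acts on $\mathbb{C}^n$ by complexification of its action on $\mathbb{R}^n$. Euclidean space is $\mathbb{E}^n=G/K$, identified with $\mathbb{R}^n$. For $\xi\in\mathbb{C}^n$ define $\varphi_\xi^K:\mathbb{E}^n\to\mathbb{C}$ by $\varphi_\xi^K(x)=\int_K e^{i\,b(x,k(\xi))}\,d\mu_K(k)$, where $\mu_K$ is the Haar measure on $K$ of total mass $1$. Complexification: if $\mathfrak{k}$ is the Lie algebra of $K$ and $\mathfrak{k}_{\mathbb{C}}=\mathfrak{k}\otimes_{\mathbb{R}}\mathbb{C}\subset\mathfrak{gl}(n;\mathbb{C})$, let $K_{\mathbb{C}}^0$ be the analytic subgroup of $GL(n;\mathbb{C})$ with Lie algebra $\mathfrak{k}_{\mathbb{C}}$; then $K_{\mathbb{C}}:=K K_{\mathbb{C}}^0$, a closed complex subgroup of $O(n;\mathbb{C})$. $K_{\mathbb{C}}(\xi)$ denotes the $K_{\mathbb{C}}$-orbit of $\xi$. Categorical quotient: $\mathbb{C}^n/\!/K_{\mathbb{C}}$ is the set of equivalence classes for the relation $\xi\sim\xi'$ iff $p(\xi)=p(\xi')$ for all $K_{\mathbb{C}}$-invariant polynomials $p$ on $\mathbb{C}^n$, with the structure of affine variety whose algebra of regular functions is the algebra of $K_{\mathbb{C}}$-invariant polynomials; $\pi$ is the quotient projection. A function $\varphi:G\to\mathbb{C}$ is $(G,K)$-spherical if it is continuous,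 bi-$K$-invariant, $\varphi(1)=1$, and for every continuous compactly supported bi-$K$-invariant function $f$ on $G$ there is $\lambda_f\in\mathbb{C}$ with $f*\varphi=\lambda_f\varphi$. Right-$K$-invariant functions on $G$ are identified with functions on $\mathbb{E}^n=G/K$. It is known that each $\varphi_\xi^K$ (lifted to $G$) is $(G,K)$-spherical. *)

theory Defs
  imports "HOL-Analysis.Analysis" "HOL-Algebra.Generated_Groups"
begin

definition orthogonal_group :: "(real^'n^'n) monoid" where
  "orthogonal_group = \<lparr>carrier = {A. orthogonal_matrix A}, mult = (**), one = mat 1\<rparr>"

definition complex_GL :: "(complex^'n^'n) monoid" where
  "complex_GL = \<lparr>carrier = {A. invertible A}, mult = (**), one = mat 1\<rparr>"

lemma group_orthogonal_group: "Group.group orthogonal_group"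
proof (rule groupI)
  fix A :: "real^'n^'n" assume "A \<in> carrier orthogonal_group"
  then show "\<exists>B\<in>carrier orthogonal_group. B \<otimes>\<^bsub>orthogonal_group\<^esub> A = \<one>\<^bsub>orthogonal_group\<^esub>"
    by (intro bexI[of _ "transpose A"]) (auto simp: orthogonal_group_def orthogonal_matrix_def)
qed (auto simp: orthogonal_group_def orthogonal_matrix_mul orthogonal_matrix_id matrix_mul_assoc)

lemma group_complex_GL: "Group.group complex_GL"
proof (rule groupI)
  fix A :: "complex^'n^'n" assume "A \<in> carrier complex_GL"
  then show "\<exists>B\<in>carrier complex_GL. B \<otimes>\<^bsub>complex_GL\<^esub> A = \<one>\<^bsub>complex_GL\<^esub>"
    by (auto simp: complex_GL_def invertible_def)
next
  show "\<one>\<^bsub>complex_GL\<^esub> \<in> carrier (complex_GL :: (complex^'n^'n) monoid)"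
    by (auto simp: complex_GL_def invertible_def intro: exI[of _ "mat 1"])
qed (auto simp: complex_GL_def invertible_mult matrix_mul_assoc)

definition complexify_vec :: "real^'n \<Rightarrow> complex^'n" where
  "complexify_vec x = (\<chi> i. complex_of_real (x $ i))"

definition complexify_mat :: "real^'n^'n \<Rightarrow> complex^'n^'n" where
  "complexify_mat A = map_matrix complex_of_real A"

text \<open>The library's \<open>exp\<close> does not apply to matrices: multiplication on \<open>'a^'n^'n\<close> as a
  type-class operation is entrywise, not the matrix product.\<close>

definition mat_exp :: "('a::real_normed_field)^'n^'n \<Rightarrow> 'a^'n^'n" where
  "mat_exp A = (\<Sum>k. (1 / fact k) *\<^sub>R (((**) A ^^ k) (mat 1)))"

definition lie_algebra :: "(real^'n^'n) set \<Rightarrow> (real^'n^'n) set" where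
  "lie_algebra K = {X. \<forall>t::real. mat_exp (t *\<^sub>R X) \<in> K}"

text \<open>The tensor product of \<open>lie_algebra K\<close> with the complex numbers, realised inside
  gl(n;C) as the set of all \<open>X + iY\<close> with \<open>X\<close>, \<open>Y\<close> in \<open>lie_algebra K\<close>.\<close>

definition complexified_lie_algebra :: "(real^'n^'n) set \<Rightarrow> (complex^'n^'n) set" where
  "complexified_lie_algebra K =
     {(\<chi> i j. Complex (X $ i $ j) (Y $ i $ j)) | X Y. X \<in> lie_algebra K \<and> Y \<in> lie_algebra K}"

text \<open>The analytic (connected Lie) subgroup of GL(n;C) with a given Lie algebra is the
  subgroup generated by the exponentials of that Lie algebra.\<close>

definition analytic_subgroup :: "(complex^'n^'n) set \<Rightarrow> (complex^'n^'n) set" where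
  "analytic_subgroup L = generate complex_GL (mat_exp ` L)"

definition complexification :: "(real^'n^'n) set \<Rightarrow> (complex^'n^'n) set" where
  "complexification K =
     {complexify_mat k ** A | k A. k \<in> K \<and> A \<in> analytic_subgroup (complexified_lie_algebra K)}"

definition matrix_orbit :: "(complex^'n^'n) set \<Rightarrow> complex^'n \<Rightarrow> (complex^'n) set" where
  "matrix_orbit H \<xi> = (\<lambda>A. A *v \<xi>) ` H"

text \<open>For a compact matrix group \<open>K\<close>, a left-invariant Borel probability measure is the
  Haar measure of total mass 1; regularity is automatic on a compact metric space.\<close>

definition normalized_haar_measure ::
    "(real^'n^'n) set \<Rightarrow> (real^'n^'n) measure \<Rightarrow> bool" where
  "normalized_haar_measure K \<mu> \<longleftrightarrow>
     sets \<mu> = sets (restrict_space borel K) \<and>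
     emeasure \<mu> (space \<mu>) = 1 \<and>
     (\<forall>k\<in>K. distr \<mu> \<mu> (\<lambda>h. k ** h) = \<mu>)"

text \<open>The C-bilinear (not Hermitian) extension of the inner product of R^n.\<close>

definition cbilin :: "complex^'n \<Rightarrow> complex^'n \<Rightarrow> complex" where
  "cbilin z w = (\<Sum>i\<in>UNIV. z $ i * w $ i)"

text \<open>The function on \<open>G/K = R^n\<close>; the group \<open>K\<close> enters through its Haar measure \<open>\<mu>\<close>, whose
  underlying space is \<open>K\<close>.\<close>

definition spherical_fun ::
    "(real^'n^'n) measure \<Rightarrow> complex^'n \<Rightarrow> real^'n \<Rightarrow> complex" where
  "spherical_fun \<mu> \<xi> x =
     (LINT k|\<mu>. exp (\<i> * cbilin (complexify_vec x) (complexify_mat k *v \<xi>)))"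

definition complex_polynomial :: "(complex^'n \<Rightarrow> complex) \<Rightarrow> bool" where
  "complex_polynomial p \<longleftrightarrow>
     (\<exists>(S :: ('n \<Rightarrow> nat) set) c. finite S \<and>
        (\<forall>z. p z = (\<Sum>\<alpha>\<in>S. c \<alpha> * (\<Prod>i\<in>UNIV. (z $ i) ^ \<alpha> i))))"

definition invariant_polynomials :: "(complex^'n^'n) set \<Rightarrow> (complex^'n \<Rightarrow> complex) set" where
  "invariant_polynomials H =
     {p. complex_polynomial p \<and> (\<forall>A\<in>H. \<forall>z. p (A *v z) = p z)}"

definition quotient_rel :: "(complex^'n^'n) set \<Rightarrow> ((complex^'n) \<times> (complex^'n)) set" where
  "quotient_rel H = {(z, w). \<forall>p\<in>invariant_polynomials H. p z = p w}"

text \<open>The points of the categorical quotient. Its regular functions are the functions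
  induced by \<open>invariant_polynomials H\<close>.\<close>

definition categorical_quotient :: "(complex^'n^'n) set \<Rightarrow> (complex^'n) set set" where
  "categorical_quotient H = UNIV // quotient_rel H"

definition quotient_projection :: "(complex^'n^'n) set \<Rightarrow> complex^'n \<Rightarrow> (complex^'n) set" where
  "quotient_projection H z = quotient_rel H `` {z}"

lemma quotient_projection_in: "quotient_projection H z \<in> categorical_quotient H"
  by (simp add: quotient_projection_def categorical_quotient_def quotientI)

end

theory Submission
  imports Defs
begin

text \<open>
  A \<open>K\<close>-invariant polynomial is automatically \<open>K\<^sub>C\<close>-invariant, since its derivative is complex
  linear. Averaging over \<open>K\<close> produces all invariant polynomials, so \<open>\<xi>\<close> and \<open>\<xi>'\<close> have the same
  invariants iff every polynomial has the same mean over \<open>K \<xi>\<close> and \<open>K \<xi>'\<close>. Expanding the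
  exponential, resp. differentiating in \<open>x\<close>, identifies this with equality of the spherical
  functions.

  If the invariants agree, pick vectors \<open>v\<close>, \<open>v'\<close> of minimal length in the two orbit closures, say
  with \<open>|v'| \<le> |v|\<close>. As the moment map vanishes at \<open>v\<close>, the Hermitian product \<open>\<langle>k v, v\<rangle>\<close> is
  real up to \<open>o(|k v - v|\<^sup>2)\<close>. Comparing the means of \<open>(1 - r \<langle>z, v\<rangle> / |v|\<^sup>2)\<^sup>-\<^sup>m\<close> over \<open>K v\<close> and
  \<open>K v'\<close> as \<open>r\<close> tends to 1 gives \<open>k v' = v\<close> for some \<open>k\<close>, so \<open>v\<close> lies in both closures.
\<close>

section \<open>Endomorphisms as a Banach algebra\<close>

text \<open>The hard implication is that agreement of the invariants makes the orbit closures meet.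
  Classically this separation is algebraic geometry; here the compactness of \<open>K\<close>, its
  Haar measure and a test function that is a limit of polynomials take over.

  The obstacle is cancellation. At \<open>k v\<close> the base \<open>1 - r <k v, v> / |v|^2\<close>
  has real part \<open>1 - r + r |k v - v|^2 / (2 |v|^2)\<close>, so an imaginary part linear in
  \<open>k v - v\<close> would dominate it and rotate the phase of the inverse power. Minimality of
  \<open>v\<close> removes the linear term. But minimality is a statement about the Lie algebra,
  that is, about one-parameter groups, while the mean runs over all of \<open>K\<close>. So elements
  of \<open>K\<close> near 1 have to be recognised as exponentials, which is why the closed subgroup
  theorem is proved for \<open>K\<close>.

  The exponent \<open>m\<close> only has to beat the rate at which the measure of
  \<open>{k. |k v - v| \<le> \<rho>}\<close> tends to 0 with \<open>\<rho>\<close>; any polynomial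
  rate will do, so a crude count of cells is enough.\<close>

typedef (overloaded) 'a endo = "UNIV :: ('a::euclidean_space \<Rightarrow>\<^sub>L 'a) set"
  morphisms blinfun_of_endo endo_of_blinfun ..

setup_lifting type_definition_endo

text \<open>Here \<open>*\<close> is composition and \<open>1\<close> the identity, so
  \<open>exp\<close> on this type is the operator exponential with its series and derivative rules;
  on \<open>'a^'n^'n\<close> the product \<open>*\<close> is entrywise.\<close>

instantiation endo :: (euclidean_space) real_normed_algebra_1
begin

lift_definition zero_endo :: "'a endo" is 0 .
lift_definition one_endo :: "'a endo" is id_blinfun .
lift_definition plus_endo :: "'a endo \<Rightarrow> 'a endo \<Rightarrow> 'a endo" is "(+)" .
lift_definition minus_endo :: "'a endo \<Rightarrow> 'a endo \<Rightarrow> 'a endo" is "(-)" .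
lift_definition uminus_endo :: "'a endo \<Rightarrow> 'a endo" is uminus .
lift_definition times_endo :: "'a endo \<Rightarrow> 'a endo \<Rightarrow> 'a endo" is "(o\<^sub>L)" .
lift_definition scaleR_endo :: "real \<Rightarrow> 'a endo \<Rightarrow> 'a endo" is scaleR .
lift_definition norm_endo :: "'a endo \<Rightarrow> real" is norm .
lift_definition dist_endo :: "'a endo \<Rightarrow> 'a endo \<Rightarrow> real" is dist .

definition uniformity_endo :: "('a endo \<times> 'a endo) filter" where
  "uniformity_endo = (INF e\<in>{0<..}. principal {(x, y). dist x y < e})"
definition open_endo :: "'a endo set \<Rightarrow> bool" where
  "open_endo U = (\<forall>x\<in>U. \<forall>\<^sub>F (x', y) in uniformity. x' = x \<longrightarrow> y \<in> U)"
definition sgn_endo :: "'a endo \<Rightarrow> 'a endo" where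
  "sgn_endo x = inverse (norm x) *\<^sub>R x"

instance
proof
  fix X Y Z :: "'a endo" and a b :: real
  show "dist X Y = norm (X - Y)" by transfer (simp add: dist_norm)
  show "X + Y + Z = X + (Y + Z)" by transfer simp
  show "X + Y = Y + X" by transfer simp
  show "0 + X = X" by transfer simp
  show "- X + X = 0" by transfer simp
  show "X - Y = X + - Y" by transfer simp
  show "a *\<^sub>R (X + Y) = a *\<^sub>R X + a *\<^sub>R Y" by transfer (simp add: scaleR_right_distrib)
  show "(a + b) *\<^sub>R X = a *\<^sub>R X + b *\<^sub>R X" by transfer (simp add: scaleR_left_distrib)
  show "a *\<^sub>R b *\<^sub>R X = (a * b) *\<^sub>R X" by transfer simp
  show "1 *\<^sub>R X = X" by transfer simp
  show "norm X = 0 \<longleftrightarrow> X = 0" by transfer simp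
  show "norm (X + Y) \<le> norm X + norm Y" by transfer (rule norm_triangle_ineq)
  show "norm (a *\<^sub>R X) = \<bar>a\<bar> * norm X" by transfer simp
  show "X * Y * Z = X * (Y * Z)" by transfer (auto intro: blinfun_eqI)
  show "(X + Y) * Z = X * Z + Y * Z" by transfer (auto intro!: blinfun_eqI simp: blinfun.bilinear_simps)
  show "X * (Y + Z) = X * Y + X * Z" by transfer (auto intro!: blinfun_eqI simp: blinfun.bilinear_simps)
  show "a *\<^sub>R X * Y = a *\<^sub>R (X * Y)" by transfer (auto intro!: blinfun_eqI simp: blinfun.bilinear_simps)
  show "X * a *\<^sub>R Y = a *\<^sub>R (X * Y)" by transfer (auto intro!: blinfun_eqI simp: blinfun.bilinear_simps)
  show "1 * X = X" by transfer (auto intro!: blinfun_eqI)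
  show "X * 1 = X" by transfer (auto intro!: blinfun_eqI)
  show n1: "norm (1 :: 'a endo) = 1" by transfer (rule norm_blinfun_id)
  show "(0 :: 'a endo) \<noteq> 1"
  proof
    assume eq: "(0 :: 'a endo) = 1"
    have "norm (0 :: 'a endo) = 0" by transfer simp
    with n1 eq show False by simp
  qed
  show "norm (X * Y) \<le> norm X * norm Y" by transfer (rule norm_blinfun_compose)
qed (auto simp: uniformity_endo_def open_endo_def sgn_endo_def)

end

lemma dist_blinfun_of_endo: "dist (blinfun_of_endo X) (blinfun_of_endo Y) = dist X Y"
  by (simp add: dist_endo.rep_eq)

lemma tendsto_blinfun_of_endo_iff:
  "(f \<longlongrightarrow> X) F \<longleftrightarrow> ((\<lambda>x. blinfun_of_endo (f x)) \<longlongrightarrow> blinfun_of_endo X) F"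
  by (subst (1 2) tendsto_dist_iff) (simp add: dist_blinfun_of_endo)

instance endo :: (euclidean_space) banach
proof
  fix X :: "nat \<Rightarrow> 'a endo"
  assume "Cauchy X"
  then have "Cauchy (\<lambda>n. blinfun_of_endo (X n))"
    by (simp add: Cauchy_def dist_blinfun_of_endo)
  then obtain L where "(\<lambda>n. blinfun_of_endo (X n)) \<longlonglongrightarrow> L"
    using Cauchy_convergent convergent_def by blast
  then have "X \<longlonglongrightarrow> endo_of_blinfun L"
    by (simp add: tendsto_blinfun_of_endo_iff endo_of_blinfun_inverse)
  then show "convergent X"
    by (auto simp: convergent_def)
qed

text \<open>Finite dimension enters here: the nearest-point argument for the exponential map uses
  compact balls in the Lie algebra and convergent subsequences of unit vectors.\<close>

instance endo :: (euclidean_space) heine_borel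
proof
  fix X :: "nat \<Rightarrow> 'a endo"
  assume "bounded (range X)"
  then obtain B where "norm (X n) \<le> B" for n
    by (auto simp: bounded_iff)
  then have "bounded (range (\<lambda>n. blinfun_of_endo (X n)))"
    by (auto simp: bounded_iff norm_endo.rep_eq)
  then obtain L r where "strict_mono r" "((\<lambda>n. blinfun_of_endo (X n)) \<circ> r) \<longlonglongrightarrow> L"
    using bounded_imp_convergent_subsequence by blast
  then have "strict_mono r \<and> (X \<circ> r) \<longlonglongrightarrow> endo_of_blinfun L"
    by (simp add: tendsto_blinfun_of_endo_iff endo_of_blinfun_inverse o_def)
  then show "\<exists>l r. strict_mono r \<and> (X \<circ> r) \<longlonglongrightarrow> l"
    by blast
qed

section \<open>Closed subgroups and the exponential map\<close>

lemma norm_power_diff_le: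
  fixes A B :: "'a::real_normed_algebra_1" and a b :: real
  assumes A: "norm A \<le> a" and B: "norm B \<le> b" and ab: "1 \<le> a" "a \<le> b"
  shows "norm (A ^ n - B ^ n) \<le> n * b ^ n * norm (A - B)"
proof (induction n)
  case (Suc n)
  have b1: "1 \<le> b" using ab by simp
  have "A ^ Suc n - B ^ Suc n = A * (A ^ n - B ^ n) + (A - B) * B ^ n"
    by (simp add: algebra_simps)
  also have "norm \<dots> \<le> norm A * norm (A ^ n - B ^ n) + norm (A - B) * norm (B ^ n)"
    by (meson add_mono norm_mult_ineq norm_triangle_le)
  also have "\<dots> \<le> b * (n * b ^ n * norm (A - B)) + norm (A - B) * b ^ n"
  proof (intro add_mono mult_mono Suc.IH)
    show "norm (B ^ n) \<le> b ^ n"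
      using norm_power_ineq[of B n] power_mono[OF B, of n] by simp
  qed (use A ab in auto)
  also have "\<dots> \<le> b * (n * b ^ n * norm (A - B)) + norm (A - B) * b ^ Suc n"
    using b1 by (intro add_left_mono mult_left_mono power_increasing) auto
  also have "\<dots> = Suc n * b ^ Suc n * norm (A - B)"
    by (simp add: algebra_simps)
  finally show ?case .
qed simp

text \<open>The same telescoping with the exact exponent, hence valid also for radii below 1; this
  keeps the constant in \<open>exp_minus_id_lipschitz\<close> small. In
  \<open>norm_power_diff_le\<close> one exponent is given away, which is harmless for a base at
  least 1.\<close>

lemma norm_power_Suc_diff_le:
  fixes A B :: "'a::real_normed_algebra_1" and r :: real
  assumes A: "norm A \<le> r" and B: "norm B \<le> r"
  shows "norm (A ^ Suc n - B ^ Suc n) \<le> Suc n * r ^ n * norm (A - B)"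
proof (induction n)
  case (Suc n)
  have r: "0 \<le> r" using A norm_ge_zero[of A] by linarith
  have "A ^ Suc (Suc n) - B ^ Suc (Suc n) = A * (A ^ Suc n - B ^ Suc n) + (A - B) * B ^ Suc n"
    by (simp add: algebra_simps)
  also have "norm \<dots> \<le> norm A * norm (A ^ Suc n - B ^ Suc n) + norm (A - B) * norm (B ^ Suc n)"
    by (meson add_mono norm_mult_ineq norm_triangle_le)
  also have "\<dots> \<le> r * (Suc n * r ^ n * norm (A - B)) + norm (A - B) * r ^ Suc n"
  proof (intro add_mono mult_mono Suc.IH)
    show "norm (B ^ Suc n) \<le> r ^ Suc n"
      using norm_power_ineq[of B "Suc n"] power_mono[OF B norm_ge_zero, of "Suc n"] by linarith
  qed (use A r in auto)
  also have "\<dots> = Suc (Suc n) * r ^ Suc n * norm (A - B)"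
    by (simp add: algebra_simps)
  finally show ?case .
qed simp

text \<open>Without the linear term only the degrees \<open>n + 2\<close> remain. Their Lipschitz
  constants \<open>r ^ (n + 1) / (n + 1)!\<close> sum to \<open>exp r - 1\<close>, which tends to 0
  with \<open>r\<close>.\<close>

lemma exp_minus_id_lipschitz:
  fixes A B :: "'a::{real_normed_algebra_1,banach}"
  assumes A: "norm A \<le> r" and B: "norm B \<le> r"
  shows "norm ((exp A - A) - (exp B - B)) \<le> (exp r - 1) * norm (A - B)"
proof -
  let ?t = "\<lambda>X::'a. \<lambda>n. inverse (fact (n + 2)) *\<^sub>R X ^ (n + 2)"
  let ?g = "\<lambda>n. inverse (fact (Suc n)) * r ^ Suc n * norm (A - B)"
  have summ: "summable (?t X)" for X
    by (rule summable_ignore_initial_segment[OF summable_exp_generic])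
  have sg0: "(\<lambda>n. inverse (fact (Suc n)) * r ^ Suc n) sums (exp r - 1)"
    using exp_converges[of r] sums_iff_shift[of "\<lambda>n. inverse (fact n) *\<^sub>R r ^ n" 1 "exp r - 1"]
    by (simp add: algebra_simps)
  then have sg: "?g sums ((exp r - 1) * norm (A - B))"
    by (rule sums_mult2)
  have "(exp A - A) - (exp B - B) = (\<Sum>n. ?t A n - ?t B n)"
    unfolding suminf_diff[OF summ summ, symmetric] exp_first_two_terms[of A] exp_first_two_terms[of B] by simp
  also have "norm \<dots> \<le> (\<Sum>n. ?g n)"
  proof (rule norm_suminf_le)
    fix n
    have "norm (?t A n - ?t B n) = inverse (fact (n + 2)) * norm (A ^ Suc (Suc n) - B ^ Suc (Suc n))"
      by (simp add: scaleR_diff_right[symmetric] del: scaleR_diff_right fact_Suc)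
    also have "\<dots> \<le> inverse (fact (n + 2)) * (Suc (Suc n) * r ^ Suc n * norm (A - B))"
      by (intro mult_left_mono norm_power_Suc_diff_le[OF A B, of "Suc n"]) auto
    also have "\<dots> = ?g n"
    proof -
      have "inverse (fact (n + 2)) * real (Suc (Suc n)) = inverse (fact (Suc n) :: real)"
        by (simp add: fact_Suc[of "Suc n"] del: fact_Suc of_nat_Suc)
      then show ?thesis
        by (simp add: mult.assoc[symmetric] del: fact_Suc of_nat_Suc)
    qed
    finally show "norm (?t A n - ?t B n) \<le> ?g n" .
  next
    show "summable ?g"
      using sg by (simp add: sums_iff)
  qed
  also have "(\<Sum>n. ?g n) = (exp r - 1) * norm (A - B)"
    using sg by (simp add: sums_iff)
  finally show ?thesis .
qed

lemma norm_exp_minus_one_minus_id: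
  fixes A :: "'a::{real_normed_algebra_1,banach}"
  shows "norm (exp A - 1 - A) \<le> (exp (norm A) - 1) * norm A"
  using exp_minus_id_lipschitz[of A "norm A" 0] by (simp add: algebra_simps)

lemma tendsto_exp_banach:
  fixes f :: "'b \<Rightarrow> 'a::{real_normed_algebra_1,banach}"
  assumes "(f \<longlongrightarrow> A) F"
  shows "((\<lambda>x. exp (f x)) \<longlongrightarrow> exp A) F"
proof -
  define r where "r = norm A + 1"
  have "\<forall>\<^sub>F x in F. norm (f x) < r"
    by (rule order_tendstoD[OF tendsto_norm[OF assms]]) (simp add: r_def)
  then have bound: "\<forall>\<^sub>F x in F. norm ((exp (f x) - f x) - (exp A - A)) \<le> (exp r - 1) * norm (f x - A)"
    by eventually_elim (rule exp_minus_id_lipschitz, auto simp: r_def)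
  have "((\<lambda>x. norm (f x - A)) \<longlongrightarrow> 0) F"
    using assms LIM_zero tendsto_norm_zero by blast
  then have "((\<lambda>x. (exp r - 1) * norm (f x - A)) \<longlongrightarrow> 0) F"
    by (rule tendsto_mult_right_zero)
  with bound have "((\<lambda>x. (exp (f x) - f x) - (exp A - A)) \<longlongrightarrow> 0) F"
    by (rule Lim_null_comparison)
  then have "((\<lambda>x. ((exp (f x) - f x) - (exp A - A)) + f x + (exp A - A)) \<longlongrightarrow> 0 + A + (exp A - A)) F"
    by (intro tendsto_intros assms)
  then show ?thesis
    by (simp add: algebra_simps)
qed

text \<open>The cubic remainder is factored with \<open>X\<close> on the outside left and
  \<open>X\<^sup>2\<close> on the right. For skew \<open>X\<close> the outer factor can be moved to
  the other side of an inner product; then both arguments contain \<open>X v\<close> and one more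
  \<open>X\<close> is left over to make the product small.\<close>

lemma exp_quadratic_remainder:
  fixes X :: "'a::{real_normed_algebra_1,banach}"
  obtains Q where "exp X = 1 + X + (1/2) *\<^sub>R X\<^sup>2 + X * Q * X\<^sup>2" and "norm Q \<le> exp (norm X)"
proof
  define q where "q = (\<lambda>n. inverse (fact (n + 3)) *\<^sub>R X ^ n)"
  have le: "norm (q n) \<le> inverse (fact n) *\<^sub>R norm X ^ n" for n
  proof -
    have "inverse (fact (n + 3)) \<le> (inverse (fact n) :: real)"
      by (intro le_imp_inverse_le fact_mono) auto
    then show ?thesis
      unfolding q_def by (auto intro!: mult_mono norm_power_ineq)
  qed
  have summ: "summable q"
    by (rule summable_comparison_test'[OF summable_exp_generic[of "norm X"]]) (use le in auto)
  have "X * suminf q * X\<^sup>2 = (\<Sum>n. X * q n * X\<^sup>2)"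
    unfolding suminf_mult[OF summ, symmetric] by (rule suminf_mult2[OF summable_mult[OF summ]])
  also have "\<dots> = (\<Sum>n. inverse (fact (n + 3)) *\<^sub>R X ^ (n + 3))"
  proof (intro arg_cong[of _ _ suminf] ext)
    fix n
    have "X * X ^ n * X\<^sup>2 = X ^ (n + 3)"
      by (simp add: power_add[symmetric] power_Suc[symmetric] eval_nat_numeral power_commutes mult.assoc del: power_Suc)
    then show "X * q n * X\<^sup>2 = inverse (fact (n + 3)) *\<^sub>R X ^ (n + 3)"
      by (simp add: q_def)
  qed
  finally show "exp X = 1 + X + (1/2) *\<^sub>R X\<^sup>2 + X * suminf q * X\<^sup>2"
    using exp_first_terms[of X 3] by (simp add: eval_nat_numeral)
  have "norm (suminf q) \<le> (\<Sum>n. inverse (fact n) *\<^sub>R norm X ^ n)"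
    by (rule norm_suminf_le[OF le summable_exp_generic])
  then show "norm (suminf q) \<le> exp (norm X)"
    by (simp add: exp_def)
qed

lemma exp_scaleR_of_nat:
  fixes X :: "'a::{real_normed_algebra_1,banach}"
  shows "exp (real n *\<^sub>R X) = exp X ^ n"
proof (induction n)
  case (Suc n)
  have "exp (X + real n *\<^sub>R X) = exp X * exp (real n *\<^sub>R X)"
    by (rule exp_add_commuting) simp
  with Suc show ?case
    by (simp add: algebra_simps)
qed simp

lemma exp_minus_left: "exp (- X) * exp X = (1::'a::{real_normed_algebra_1,banach})"
  by (metis exp_minus_inverse minus_minus)

section \<open>The closed subgroup theorem, for groups whose elements have norm at most 1\<close>

locale closed_contraction_group =
  fixes S :: "'a::{real_normed_algebra_1,banach,heine_borel} set"
  assumes closed: "closed S"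
    and one: "1 \<in> S"
    and mult: "\<And>x y. x \<in> S \<Longrightarrow> y \<in> S \<Longrightarrow> x * y \<in> S"
    and inverse: "\<And>x. x \<in> S \<Longrightarrow> \<exists>y\<in>S. x * y = 1"
    and norm_le: "\<And>x. x \<in> S \<Longrightarrow> norm x \<le> 1"
begin

definition lie :: "'a set" where
  "lie = {X. \<forall>t::real. exp (t *\<^sub>R X) \<in> S}"

lemma exp_uminus_mem:
  assumes "exp X \<in> S"
  shows "exp (- X) \<in> S"
proof -
  obtain y where y: "y \<in> S" "exp X * y = 1"
    using inverse[OF assms] by blast
  have "exp (- X) = exp (- X) * (exp X * y)"
    by (simp add: y)
  also have "\<dots> = y"
    by (simp add: exp_minus_left mult.assoc[symmetric])
  finally show ?thesis
    using y by simp
qed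

lemma power_mem: "x \<in> S \<Longrightarrow> x ^ n \<in> S"
  by (induction n) (auto intro: one mult)

text \<open>As \<open>k n\<close> is \<open>exp (t n Z)\<close> up to o(\<open>t n\<close>), its
  power with exponent \<open>m n\<close>, about \<open>s / t n\<close>, is \<open>exp (s Z)\<close>
  up to o(1). The norm bound on \<open>S\<close> keeps these powers bounded, and closedness of
  \<open>S\<close> gives the limit.\<close>

lemma tangent_nonneg:
  assumes kS: "\<And>n. k n \<in> S" and t: "\<And>n. t n > 0" "t \<longlonglongrightarrow> 0"
    and lim: "(\<lambda>n. (k n - 1) /\<^sub>R t n) \<longlonglongrightarrow> Z" and s: "s \<ge> 0"
  shows "exp (s *\<^sub>R Z) \<in> S"
proof -
  define m where "m n = nat \<lfloor>s / t n\<rfloor>" for n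
  define b where "b n = exp (t n * norm Z)" for n
  have mt: "m n * t n \<le> s" "s - t n \<le> m n * t n" for n
  proof -
    have "real (m n) = of_int \<lfloor>s / t n\<rfloor>"
      using s t(1)[of n] by (simp add: m_def)
    then have "real (m n) \<le> s / t n" "s / t n - 1 \<le> real (m n)"
      by linarith+
    then show "m n * t n \<le> s" "s - t n \<le> m n * t n"
      using t(1)[of n] by (simp_all add: field_simps)
  qed
  have "(\<lambda>n. m n * t n) \<longlonglongrightarrow> s"
    by (rule tendsto_sandwich[where f = "\<lambda>n. s - t n" and h = "\<lambda>n. s"])
       (use mt tendsto_diff[OF tendsto_const t(2), of s] in auto)
  then have expm: "(\<lambda>n. exp (t n *\<^sub>R Z) ^ m n) \<longlonglongrightarrow> exp (s *\<^sub>R Z)"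
    unfolding exp_scaleR_of_nat[symmetric] scaleR_scaleR
    by (intro tendsto_exp_banach tendsto_intros)
  \<comment> \<open>\<open>t n * e n\<close> bounds the distance from \<open>k n\<close> to
    \<open>exp (t n Z)\<close>: the first summand is the error of the difference quotient, the
    second the nonlinear part of the exponential.\<close>
  define e where "e n = norm ((k n - 1) /\<^sub>R t n - Z) + (exp (t n * norm Z) - 1) * norm Z" for n
  have "e \<longlonglongrightarrow> norm (Z - Z) + (exp (0 * norm Z) - 1) * norm Z"
    unfolding e_def by (intro tendsto_intros lim t)
  then have "e \<longlonglongrightarrow> 0"
    by simp
  then have e0: "(\<lambda>n. s * exp (s * norm Z) * e n) \<longlonglongrightarrow> 0"
    by (rule tendsto_mult_right_zero)
  have "norm (k n ^ m n - exp (t n *\<^sub>R Z) ^ m n) \<le> s * exp (s * norm Z) * e n" for n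
  proof -
    have tn: "t n > 0" by (rule t)
    have "norm (k n - exp (t n *\<^sub>R Z)) \<le> norm (k n - 1 - t n *\<^sub>R Z) + norm (exp (t n *\<^sub>R Z) - 1 - t n *\<^sub>R Z)"
      using norm_triangle_ineq4[of "k n - 1 - t n *\<^sub>R Z" "exp (t n *\<^sub>R Z) - 1 - t n *\<^sub>R Z"]
      by (simp add: algebra_simps)
    also have "norm (k n - 1 - t n *\<^sub>R Z) = t n * norm ((k n - 1) /\<^sub>R t n - Z)"
    proof -
      have "k n - 1 - t n *\<^sub>R Z = t n *\<^sub>R ((k n - 1) /\<^sub>R t n - Z)"
        using tn by (simp add: algebra_simps)
      then show ?thesis
        using tn by (simp only: norm_scaleR)
    qed
    also have "norm (exp (t n *\<^sub>R Z) - 1 - t n *\<^sub>R Z) \<le> (exp (t n * norm Z) - 1) * (t n * norm Z)"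
      using norm_exp_minus_one_minus_id[of "t n *\<^sub>R Z"] tn by simp
    finally have d: "norm (k n - exp (t n *\<^sub>R Z)) \<le> t n * e n"
      by (simp add: e_def algebra_simps)
    have nb: "norm (exp (t n *\<^sub>R Z)) \<le> b n"
      unfolding b_def using norm_exp[of "t n *\<^sub>R Z"] tn by simp
    have "norm (k n ^ m n - exp (t n *\<^sub>R Z) ^ m n) \<le> m n * b n ^ m n * norm (k n - exp (t n *\<^sub>R Z))"
      by (rule norm_power_diff_le[OF norm_le[OF kS] nb]) (use tn in \<open>auto simp: b_def\<close>)
    also have "\<dots> \<le> m n * b n ^ m n * (t n * e n)"
      by (intro mult_left_mono d) (auto simp: b_def)
    also have "\<dots> = (m n * t n) * b n ^ m n * e n"
      by simp
    also have "\<dots> \<le> s * exp (s * norm Z) * e n"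
    proof (intro mult_right_mono mult_mono)
      have "b n ^ m n = exp ((m n * t n) * norm Z)"
        by (simp add: b_def exp_of_nat_mult[symmetric] mult.assoc)
      also have "\<dots> \<le> exp (s * norm Z)"
        using mt(1)[of n] by (simp add: mult_right_mono)
      finally show "b n ^ m n \<le> exp (s * norm Z)" .
      have "e n \<ge> 0 + 0"
        unfolding e_def using tn by (intro add_mono mult_nonneg_nonneg) auto
      then show "0 \<le> e n" by simp
    qed (use mt s in \<open>auto simp: b_def\<close>)
    finally show ?thesis .
  qed
  then have "(\<lambda>n. k n ^ m n - exp (t n *\<^sub>R Z) ^ m n) \<longlonglongrightarrow> 0"
    by (intro Lim_null_comparison[OF _ e0] always_eventually allI)
  then have "(\<lambda>n. (k n ^ m n - exp (t n *\<^sub>R Z) ^ m n) + exp (t n *\<^sub>R Z) ^ m n) \<longlonglongrightarrow> 0 + exp (s *\<^sub>R Z)"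
    by (intro tendsto_add expm)
  then have "(\<lambda>n. k n ^ m n) \<longlonglongrightarrow> exp (s *\<^sub>R Z)"
    by simp
  then show ?thesis
    by (rule closed_sequentially[OF closed power_mem[OF kS]])
qed

lemma tangent:
  assumes "\<And>n. k n \<in> S" "\<And>n. t n > 0" "t \<longlonglongrightarrow> 0" "(\<lambda>n. (k n - 1) /\<^sub>R t n) \<longlonglongrightarrow> Z"
  shows "Z \<in> lie"
  unfolding lie_def
proof safe
  fix s :: real
  show "exp (s *\<^sub>R Z) \<in> S"
  proof (cases "s \<ge> 0")
    case False
    then show ?thesis
      using exp_uminus_mem[OF tangent_nonneg[OF assms, of "-s"]] by simp
  qed (use tangent_nonneg[OF assms] in auto)
qed

lemma lie_scaleR: "X \<in> lie \<Longrightarrow> c *\<^sub>R X \<in> lie"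
  by (auto simp: lie_def)

lemma lie_exp: "X \<in> lie \<Longrightarrow> exp X \<in> S"
  unfolding lie_def by (metis (mono_tags) mem_Collect_eq scaleR_one)

lemma lie_zero: "0 \<in> lie"
  by (simp add: lie_def one)

text \<open>The curve \<open>exp (t X) * exp (t Y)\<close> stays in \<open>S\<close> and has
  velocity \<open>X + Y\<close> at 0, so \<open>tangent\<close> applies to its difference
  quotients.\<close>

lemma lie_add:
  assumes X: "X \<in> lie" and Y: "Y \<in> lie"
  shows "X + Y \<in> lie"
proof (rule tangent)
  define t :: "nat \<Rightarrow> real" where "t n = 1 / real (Suc n)" for n
  define f where "f t = exp (t *\<^sub>R X) * exp (t *\<^sub>R Y)" for t :: real
  have "(f has_vector_derivative (exp (0 *\<^sub>R X) * (exp (0 *\<^sub>R Y) * Y) + (exp (0 *\<^sub>R X) * X) * exp (0 *\<^sub>R Y))) (at 0)"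
    unfolding f_def
    by (rule has_vector_derivative_mult[OF exp_scaleR_has_vector_derivative_right exp_scaleR_has_vector_derivative_right])
  then have "(f has_vector_derivative (X + Y)) (at 0)"
    by (simp add: add.commute)
  then have "((\<lambda>h. norm ((f h - f 0 - h *\<^sub>R (X + Y)) /\<^sub>R norm h)) \<longlongrightarrow> 0) (at 0)"
    by (simp add: has_vector_derivative_def has_derivative_at divide_inverse mult.commute)
  then have lim0: "((\<lambda>h. (f h - f 0 - h *\<^sub>R (X + Y)) /\<^sub>R norm h) \<longlongrightarrow> 0) (at 0)"
    by (rule tendsto_norm_zero_cancel)
  have t0: "t \<longlonglongrightarrow> 0" unfolding t_def by (rule LIMSEQ_Suc[OF lim_1_over_n])
  have tpos: "t n > 0" for n by (simp add: t_def)
  have "filterlim t (at 0) sequentially"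
    using t0 tpos by (auto simp: filterlim_at intro!: always_eventually) (metis less_irrefl)
  from filterlim_compose[OF lim0 this]
  have "(\<lambda>n. (f (t n) - f 0 - t n *\<^sub>R (X + Y)) /\<^sub>R norm (t n)) \<longlonglongrightarrow> 0" .
  moreover have "(f (t n) - f 0 - t n *\<^sub>R (X + Y)) /\<^sub>R norm (t n) = (f (t n) - 1) /\<^sub>R t n - (X + Y)" for n
    using tpos[of n] by (simp add: f_def scaleR_diff_right del: scaleR_add_right)
  ultimately show "(\<lambda>n. (f (t n) - 1) /\<^sub>R t n) \<longlonglongrightarrow> X + Y"
    by (simp add: LIM_zero_iff)
  show "f (t n) \<in> S" for n
    using X Y by (simp add: f_def lie_def mult)
  show "0 < t n" for n by (rule tpos)
  show "t \<longlonglongrightarrow> 0" by (rule t0)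
qed

lemma closed_lie: "closed lie"
proof -
  have "closed ((\<lambda>X. exp (t *\<^sub>R X)) -` S)" for t
    by (rule continuous_closed_vimage[OF closed])
       (auto intro!: tendsto_exp_banach tendsto_intros simp: isCont_def)
  then have "closed (\<Inter>t. (\<lambda>X. exp (t *\<^sub>R X)) -` S)"
    by blast
  also have "(\<Inter>t. (\<lambda>X. exp (t *\<^sub>R X)) -` S) = lie"
    by (auto simp: lie_def)
  finally show ?thesis .
qed

text \<open>For \<open>k\<close> near 1 take the point \<open>exp X\<close> nearest to \<open>k\<close>, with \<open>X\<close> in a small ball of the Lie
  algebra, at distance \<open>d\<close>. If \<open>d > 0\<close>, then \<open>(exp (- X) * k - 1) / d\<close> is close to some \<open>Z\<close> in
  the Lie algebra and \<open>exp (X + d Z)\<close> is nearer to \<open>k\<close>.\<close>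

theorem exp_onto_neighbourhood:
  assumes \<epsilon>: "\<epsilon> > 0"
  shows "\<exists>\<delta>>0. \<forall>k\<in>S. norm (k - 1) < \<delta> \<longrightarrow> (\<exists>X\<in>lie. norm X < \<epsilon> \<and> exp X = k)"
proof (rule ccontr)
  assume "\<not> ?thesis"
  then have "\<forall>n. \<exists>k\<in>S. norm (k - 1) < 1 / real (Suc n) \<and> (\<forall>X\<in>lie. norm X < \<epsilon> \<longrightarrow> exp X \<noteq> k)"
    by (metis of_nat_0_less_iff zero_less_Suc zero_less_divide_1_iff)
  then obtain k where kS: "\<And>n. k n \<in> S" and kn: "\<And>n. norm (k n - 1) < 1 / real (Suc n)"
    and kX: "\<And>n X. X \<in> lie \<Longrightarrow> norm X < \<epsilon> \<Longrightarrow> exp X \<noteq> k n"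
    by metis
  \<comment> \<open>The bound \<open>ln (3 / 2)\<close> gives \<open>exp r - 1 \<le> 1 / 2\<close>,
    hence \<open>norm X \<le> 2 * norm (exp X - 1)\<close> on the ball of radius
    \<open>r\<close>.\<close>
  define r where "r = min (\<epsilon> / 2) (ln (3 / 2 :: real))"
  have r: "r > 0" "r < \<epsilon>" and "r \<le> ln (3 / 2)"
    using \<epsilon> by (auto simp: r_def)
  then have "exp r \<le> exp (ln (3 / 2))"
    by (simp only: exp_le_cancel_iff)
  then have expr: "exp r - 1 \<le> 1 / 2"
    by simp
  define C where "C = lie \<inter> cball 0 r"
  have C: "compact C" "C \<noteq> {}" "0 \<in> C"
    using closed_Int_compact[OF closed_lie compact_cball] lie_zero r by (auto simp: C_def)
  have "\<exists>X\<in>C. \<forall>Y\<in>C. norm (exp X - k n) \<le> norm (exp Y - k n)" for n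
    by (intro continuous_attains_inf C)
       (auto simp: continuous_on_def intro!: tendsto_intros tendsto_exp_banach)
  then obtain X where XC: "\<And>n. X n \<in> C" and Xmin: "\<And>n Y. Y \<in> C \<Longrightarrow> norm (exp (X n) - k n) \<le> norm (exp Y - k n)"
    by metis
  have XL: "X n \<in> lie" and Xr: "norm (X n) \<le> r" for n
    using XC[of n] by (auto simp: C_def)
  define d where "d n = norm (exp (X n) - k n)" for n
  have dpos: "d n > 0" for n
    using kX[OF XL, of n n] Xr[of n] r by (auto simp: d_def)
  have k0: "(\<lambda>n. norm (k n - 1)) \<longlonglongrightarrow> 0"
    by (rule tendsto_sandwich[OF _ _ tendsto_const LIMSEQ_Suc[OF lim_1_over_n]])
       (use kn in \<open>auto intro!: always_eventually less_imp_le\<close>)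
  have dk: "d n \<le> norm (k n - 1)" for n
    using Xmin[OF C(3), of n] by (simp add: d_def norm_minus_commute)
  have d0: "d \<longlonglongrightarrow> 0"
    by (rule tendsto_sandwich[OF _ _ tendsto_const k0]) (use dpos dk in \<open>auto intro!: always_eventually less_imp_le\<close>)
  \<comment> \<open>The nearest points come from parameters tending to 0, which therefore end up
    inside the ball and can be moved by \<open>d n *\<^sub>R Z\<close> without leaving
    \<open>C\<close>.\<close>
  have "norm (X n) \<le> 4 * norm (k n - 1)" for n
  proof -
    have "norm (exp (X n) - 1 - X n) \<le> (exp (norm (X n)) - 1) * norm (X n)"
      by (rule norm_exp_minus_one_minus_id)
    also have "\<dots> \<le> 1 / 2 * norm (X n)"
      using expr Xr[of n] by (intro mult_right_mono) (auto intro: order_trans[rotated])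
    finally have "norm (X n) \<le> 2 * norm (exp (X n) - 1)"
      using norm_triangle_sub[of "X n" "exp (X n) - 1"] by (simp add: norm_minus_commute)
    moreover have "norm (exp (X n) - 1) \<le> d n + norm (k n - 1)"
      using norm_triangle_ineq[of "exp (X n) - k n" "k n - 1"] by (simp add: d_def)
    ultimately show ?thesis
      using dk[of n] by linarith
  qed
  then have X0: "X \<longlonglongrightarrow> 0"
    by (intro Lim_null_comparison[OF _ tendsto_mult_right_zero[OF k0, of 4]] always_eventually allI)
  define k' where "k' n = exp (- X n) * k n" for n
  have k'S: "k' n \<in> S" for n
    unfolding k'_def using mult kS exp_uminus_mem lie_exp XL by blast
  have k'k: "exp (X n) * (k' n - 1) = k n - exp (X n)" for n
    by (simp add: k'_def right_diff_distrib mult.assoc[symmetric] exp_minus_inverse)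
  have "k' n - 1 = exp (- X n) * (k n - exp (X n))" for n
    by (simp add: k'_def right_diff_distrib exp_minus_left)
  then have "norm (k' n - 1) \<le> norm (exp (- X n)) * norm (k n - exp (X n))" for n
    by (metis norm_mult_ineq)
  moreover have "norm (exp (- X n)) * norm (k n - exp (X n)) \<le> 1 * d n" for n
    unfolding d_def norm_minus_commute[of "k n"]
    by (intro mult_right_mono norm_le exp_uminus_mem lie_exp XL) auto
  moreover have "d n \<le> norm (k' n - 1)" for n
  proof -
    have "d n \<le> norm (exp (X n)) * norm (k' n - 1)"
      unfolding d_def norm_minus_commute[of "exp (X n)"] k'k[symmetric] by (rule norm_mult_ineq)
    also have "\<dots> \<le> 1 * norm (k' n - 1)"
      by (intro mult_right_mono norm_le lie_exp XL) auto
    finally show ?thesis by simp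
  qed
  \<comment> \<open>Left multiplication by \<open>exp (- X n)\<close> is isometric, since it and its
    inverse both have norm at most 1. So division by \<open>d n\<close> yields unit vectors.\<close>
  ultimately have nk': "norm (k' n - 1) = d n" for n
    by (metis antisym mult_1 order_trans)
  define u where "u n = (k' n - 1) /\<^sub>R d n" for n
  have nu: "norm (u n) = 1" for n
    using dpos[of n] by (simp add: u_def nk')
  then have "bounded (range u)"
    by (auto simp: bounded_iff intro!: exI[of _ 1])
  then obtain Z \<sigma> where \<sigma>: "strict_mono \<sigma>" and uZ: "(u \<circ> \<sigma>) \<longlonglongrightarrow> Z"
    using bounded_imp_convergent_subsequence by blast
  have Z: "Z \<in> lie"
  proof (rule tangent)
    show "(\<lambda>n. (k' (\<sigma> n) - 1) /\<^sub>R d (\<sigma> n)) \<longlonglongrightarrow> Z"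
      using uZ by (simp add: u_def o_def)
    show "(\<lambda>n. d (\<sigma> n)) \<longlonglongrightarrow> 0"
      using LIMSEQ_subseq_LIMSEQ[OF d0 \<sigma>] by (simp add: o_def)
  qed (use k'S dpos in auto)
  define \<rho> where "\<rho> n = norm (X n) + d n * norm Z" for n
  \<comment> \<open>\<open>d n * g n\<close> bounds the distance from
    \<open>exp (X n + d n Z)\<close> to \<open>k n\<close>. The terms measure the nonlinearity of
    \<open>exp\<close>, the error of \<open>Z\<close> as a limit of \<open>u\<close>, and the
    deviation of \<open>exp (X n)\<close> from 1. They tend to 0 along \<open>\<sigma>\<close>, and
    a value below 1 contradicts the choice of \<open>X n\<close>.\<close>
  define g where "g n = (exp (\<rho> n) - 1) * norm Z + norm (Z - u n) + norm (1 - exp (X n))" for n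
  have "\<rho> \<longlonglongrightarrow> norm (0::'a) + 0 * norm Z"
    unfolding \<rho>_def by (intro tendsto_intros X0 d0)
  then have \<rho>0: "(\<lambda>n. \<rho> (\<sigma> n)) \<longlonglongrightarrow> 0"
    using LIMSEQ_subseq_LIMSEQ[OF _ \<sigma>, of \<rho> 0] by (simp add: o_def)
  have X\<sigma>: "(\<lambda>n. X (\<sigma> n)) \<longlonglongrightarrow> 0"
    using LIMSEQ_subseq_LIMSEQ[OF X0 \<sigma>] by (simp add: o_def)
  have u\<sigma>: "(\<lambda>n. u (\<sigma> n)) \<longlonglongrightarrow> Z"
    using uZ by (simp add: o_def)
  have "(\<lambda>n. g (\<sigma> n)) \<longlonglongrightarrow> (exp 0 - 1) * norm Z + norm (Z - Z) + norm (1 - exp (0::'a))"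
    unfolding g_def by (intro tendsto_intros \<rho>0 u\<sigma> tendsto_exp_banach[OF X\<sigma>])
  then have g0: "(\<lambda>n. g (\<sigma> n)) \<longlonglongrightarrow> 0"
    by simp
  have "\<forall>\<^sub>F n in sequentially. \<rho> (\<sigma> n) < r \<and> g (\<sigma> n) < 1"
    using order_tendstoD(2)[OF \<rho>0 r(1)] order_tendstoD(2)[OF g0, of 1] by (simp add: eventually_conj)
  then obtain N where N: "\<rho> (\<sigma> N) < r" "g (\<sigma> N) < 1"
    using eventually_happens'[OF sequentially_bot] by blast
  define n where "n = \<sigma> N"
  let ?Y = "X n + d n *\<^sub>R Z"
  have nY: "norm ?Y \<le> \<rho> n"
    unfolding \<rho>_def using norm_triangle_ineq[of "X n" "d n *\<^sub>R Z"] dpos[of n] by simp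
  have "?Y \<in> C"
    unfolding C_def using lie_add lie_scaleR XL Z nY N by (auto simp: n_def)
  then have "d n \<le> norm (exp ?Y - k n)"
    using Xmin[of ?Y n] by (simp only: d_def[of n])
  also have "exp ?Y - k n = ((exp ?Y - ?Y) - (exp (X n) - X n)) + (d n *\<^sub>R (Z - u n) + (1 - exp (X n)) * (d n *\<^sub>R u n))"
  proof -
    have "k n - exp (X n) = exp (X n) * (d n *\<^sub>R u n)"
      using dpos[of n] by (simp add: k'k[symmetric] u_def)
    then have "k n = exp (X n) + exp (X n) * (d n *\<^sub>R u n)"
      by (simp add: algebra_simps)
    then show ?thesis
      by (simp add: algebra_simps)
  qed
  also have "norm \<dots> \<le> norm ((exp ?Y - ?Y) - (exp (X n) - X n)) + (norm (d n *\<^sub>R (Z - u n)) + norm ((1 - exp (X n)) * (d n *\<^sub>R u n)))"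
    by (meson add_left_mono norm_triangle_ineq order_trans)
  also have "\<dots> \<le> (exp (\<rho> n) - 1) * norm (?Y - X n) + (norm (d n *\<^sub>R (Z - u n)) + norm (1 - exp (X n)) * norm (d n *\<^sub>R u n))"
  proof (intro add_mono exp_minus_id_lipschitz nY norm_mult_ineq order_refl)
    show "norm (X n) \<le> \<rho> n"
      using dpos[of n] by (simp add: \<rho>_def)
  qed
  also have "\<dots> = d n * g n"
    using dpos[of n] by (simp add: g_def nu distrib_left del: scaleR_diff_right)
  also have "\<dots> < d n"
    using dpos[of n] N by (simp add: n_def)
  finally show False by simp
qed

end

section \<open>Orthogonal matrix groups\<close>

definition endo_apply :: "'a::euclidean_space endo \<Rightarrow> 'a \<Rightarrow> 'a" where
  "endo_apply E = blinfun_apply (blinfun_of_endo E)"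

lemma endo_eqI: "(\<And>x. endo_apply E x = endo_apply F x) \<Longrightarrow> E = F"
  by (metis blinfun_eqI blinfun_of_endo_inject endo_apply_def)

lemma bounded_bilinear_endo_apply: "bounded_bilinear endo_apply"
  unfolding endo_apply_def
proof (unfold_locales, goal_cases)
  case 5
  show ?case
    by (rule exI[of _ 1]) (simp add: norm_endo.rep_eq norm_blinfun)
qed (simp_all add: plus_endo.rep_eq scaleR_endo.rep_eq blinfun.bilinear_simps)

interpretation endo_apply: bounded_bilinear endo_apply
  by (rule bounded_bilinear_endo_apply)

lemma norm_endo_apply: "norm (endo_apply E x) \<le> norm E * norm x"
  by (simp add: endo_apply_def norm_endo.rep_eq norm_blinfun)

lemma endo_apply_one [simp]: "endo_apply 1 x = x"
  by (simp add: endo_apply_def one_endo.rep_eq)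

lemma endo_apply_mult [simp]: "endo_apply (E * F) x = endo_apply E (endo_apply F x)"
  by (simp add: endo_apply_def times_endo.rep_eq)

lemma norm_endo_le:
  assumes "\<And>x. norm (endo_apply E x) \<le> b * norm x" "0 \<le> b"
  shows "norm E \<le> b"
  using assms by (simp add: endo_apply_def norm_endo.rep_eq norm_blinfun_bound)

text \<open>The sort covers real and complex entries, so one transfer serves \<open>K\<close> and
  its complexification; complex matrices are viewed as real-linear maps.\<close>

definition endo_of_matrix :: "'a::{real_normed_field,euclidean_space}^'n^'n \<Rightarrow> ('a^'n) endo" where
  "endo_of_matrix A = endo_of_blinfun (Blinfun ((*v) A))"

lemma endo_apply_of_matrix [simp]: "endo_apply (endo_of_matrix A) x = A *v x"
  by (simp add: endo_apply_def endo_of_matrix_def endo_of_blinfun_inverse bounded_linear_Blinfun_apply)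

lemma endo_of_matrix_mult: "endo_of_matrix (A ** B) = endo_of_matrix A * endo_of_matrix B"
  by (rule endo_eqI) (simp add: matrix_vector_mul_assoc)

lemma endo_of_matrix_one [simp]: "endo_of_matrix (mat 1) = 1"
  by (rule endo_eqI) simp

lemma bounded_linear_endo_of_matrix:
  "bounded_linear (endo_of_matrix :: 'a::{real_normed_field,euclidean_space}^'n^'n \<Rightarrow> _)"
  unfolding linear_conv_bounded_linear[symmetric]
proof (rule linearI; rule endo_eqI)
  fix A B :: "'a^'n^'n" and c :: real and x :: "'a^'n"
  show "endo_apply (endo_of_matrix (A + B)) x = endo_apply (endo_of_matrix A + endo_of_matrix B) x"
    by (simp add: endo_apply.add_left matrix_vector_mult_add_rdistrib)
  show "endo_apply (endo_of_matrix (c *\<^sub>R A)) x = endo_apply (c *\<^sub>R endo_of_matrix A) x"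
    by (simp add: endo_apply.scaleR_left vec_eq_iff matrix_vector_mult_def scaleR_sum_right)
qed

lemmas endo_of_matrix_linear_simps =
  linear_add[OF bounded_linear.linear[OF bounded_linear_endo_of_matrix]]
  linear_scale[OF bounded_linear.linear[OF bounded_linear_endo_of_matrix]]
  linear_0[OF bounded_linear.linear[OF bounded_linear_endo_of_matrix]]

definition matrix_of_endo :: "('a::{real_normed_field,euclidean_space}^'n) endo \<Rightarrow> 'a^'n^'n" where
  "matrix_of_endo E = (\<chi> i j. endo_apply E (axis j 1) $ i)"

lemma matrix_of_endo_of_matrix [simp]: "matrix_of_endo (endo_of_matrix A) = A"
  by (simp add: matrix_of_endo_def vec_eq_iff matrix_vector_mult_def axis_def if_distrib cong: if_cong)

lemma norm_vec_le_sum: "norm (x :: 'a::real_normed_vector^'n) \<le> (\<Sum>i\<in>UNIV. norm (x $ i))"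
  by (simp add: norm_vec_def L2_set_le_sum)

lemma bounded_linear_matrix_of_endo:
  "bounded_linear (matrix_of_endo :: ('a::{real_normed_field,euclidean_space}^'n) endo \<Rightarrow> 'a^'n^'n)"
proof (rule bounded_linear_intro)
  fix E :: "('a^'n) endo"
  have "norm (axis j 1 :: 'a^'n) = 1" for j
    by (simp add: norm_vec_def L2_set_def axis_def if_distrib[of norm] if_distrib[of "\<lambda>x. x ^ 2"] cong: if_cong)
  then have "norm (endo_apply E (axis j 1) $ i) \<le> norm E * 1" for i j
    using norm_endo_apply[of E "axis j 1"] Finite_Cartesian_Product.norm_nth_le[of "endo_apply E (axis j 1)" i]
    by simp
  then have "norm (matrix_of_endo E) \<le> (\<Sum>i\<in>(UNIV::'n set). \<Sum>j\<in>(UNIV::'n set). norm E * 1)"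
    by (intro order_trans[OF norm_vec_le_sum] sum_mono) (simp add: matrix_of_endo_def)
  then show "norm (matrix_of_endo E) \<le> norm E * (CARD('n) * CARD('n))"
    by (simp add: mult_ac)
qed (simp_all add: matrix_of_endo_def vec_eq_iff endo_apply.add_left endo_apply.scaleR_left)

lemma endo_of_matrix_inject: "endo_of_matrix A = endo_of_matrix B \<longleftrightarrow> A = B"
  by (metis matrix_of_endo_of_matrix)

text \<open>Stated for real entries only: on \<open>complex^'n\<close> an endomorphism is merely
  real linear and need not come from a complex matrix.\<close>

lemma endo_of_matrix_of_endo:
  fixes E :: "(real^'n) endo"
  shows "endo_of_matrix (matrix_of_endo E) = E"
proof (rule endo_eqI)
  fix x
  have "linear (endo_apply E)"
    using endo_apply.bounded_linear_right bounded_linear.linear by blast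
  then have "matrix (endo_apply E) *v x = endo_apply E x"
    by (simp add: linear_matrix_vector_mul_eq)
  then show "endo_apply (endo_of_matrix (matrix_of_endo E)) x = endo_apply E x"
    by (simp add: matrix_of_endo_def matrix_def)
qed

lemma endo_of_matrix_funpow: "endo_of_matrix (((**) A ^^ k) (mat 1)) = endo_of_matrix A ^ k"
  by (induction k) (auto simp: endo_of_matrix_mult)

text \<open>The operator series converges, and the continuous left inverse
  \<open>matrix_of_endo\<close> carries it to the matrix series. So the \<open>suminf\<close> in
  \<open>mat_exp\<close> is a genuine limit.\<close>

lemma mat_exp_sums:
  fixes A :: "'a::{real_normed_field,euclidean_space}^'n^'n"
  shows "(\<lambda>k. (1 / fact k) *\<^sub>R ((**) A ^^ k) (mat 1)) sums mat_exp A"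
    and "endo_of_matrix (mat_exp A) = exp (endo_of_matrix A)"
proof -
  let ?t = "\<lambda>k. (1 / fact k) *\<^sub>R ((**) A ^^ k) (mat 1)"
  have t: "endo_of_matrix (?t k) = endo_of_matrix A ^ k /\<^sub>R fact k" for k
    by (simp add: endo_of_matrix_linear_simps endo_of_matrix_funpow divide_inverse)
  then have e: "(\<lambda>k. endo_of_matrix (?t k)) sums exp (endo_of_matrix A)"
    using exp_converges[of "endo_of_matrix A"] by simp
  from bounded_linear.sums[OF bounded_linear_matrix_of_endo e]
  have "?t sums matrix_of_endo (exp (endo_of_matrix A))"
    by simp
  then show s: "?t sums mat_exp A"
    by (simp add: mat_exp_def sums_iff)
  from bounded_linear.sums[OF bounded_linear_endo_of_matrix s] e
  show "endo_of_matrix (mat_exp A) = exp (endo_of_matrix A)"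
    by (rule sums_unique2)
qed

lemma mat_exp_zero [simp]: "mat_exp (0 :: 'a::{real_normed_field,euclidean_space}^'n^'n) = mat 1"
  by (simp add: endo_of_matrix_inject[symmetric] mat_exp_sums endo_of_matrix_linear_simps)

lemma complexify_mat_mult: "complexify_mat (A ** B) = complexify_mat A ** complexify_mat B"
  by (simp add: complexify_mat_def vec_eq_iff matrix_matrix_mult_def)

lemma complexify_mat_one [simp]: "complexify_mat (mat 1) = mat 1"
  by (simp add: complexify_mat_def vec_eq_iff mat_def)

lemma bounded_linear_complexify_mat: "bounded_linear (complexify_mat :: real^'n^'n \<Rightarrow> _)"
  unfolding linear_conv_bounded_linear[symmetric]
  by (rule linearI) (simp_all add: complexify_mat_def vec_eq_iff, simp add: scaleR_conv_of_real)

lemmas complexify_mat_linear_simps =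
  linear_add[OF bounded_linear.linear[OF bounded_linear_complexify_mat]]
  linear_scale[OF bounded_linear.linear[OF bounded_linear_complexify_mat]]
  linear_0[OF bounded_linear.linear[OF bounded_linear_complexify_mat]]

lemma complexify_mat_exp: "complexify_mat (mat_exp A) = mat_exp (complexify_mat A)"
proof -
  have "complexify_mat (((**) A ^^ k) (mat 1)) = ((**) (complexify_mat A) ^^ k) (mat 1)" for k
    by (induction k) (auto simp: complexify_mat_mult)
  with bounded_linear.sums[OF bounded_linear_complexify_mat mat_exp_sums(1)[of A]]
  have "(\<lambda>k. (1 / fact k) *\<^sub>R ((**) (complexify_mat A) ^^ k) (mat 1)) sums complexify_mat (mat_exp A)"
    by (simp add: complexify_mat_linear_simps)
  then show ?thesis
    using mat_exp_sums(1) sums_unique2 by blast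
qed

definition cendo :: "real^'n^'n \<Rightarrow> (complex^'n) endo" where
  "cendo A = endo_of_matrix (complexify_mat A)"

lemma cendo_apply [simp]: "endo_apply (cendo A) z = complexify_mat A *v z"
  by (simp add: cendo_def)

lemma cendo_exp: "cendo (mat_exp A) = exp (cendo A)"
  by (simp add: cendo_def complexify_mat_exp mat_exp_sums)

lemma bounded_linear_cendo: "bounded_linear cendo"
  unfolding cendo_def by (intro bounded_linear_compose[OF bounded_linear_endo_of_matrix bounded_linear_complexify_mat])

lemmas cendo_linear_simps =
  linear_add[OF bounded_linear.linear[OF bounded_linear_cendo]]
  linear_scale[OF bounded_linear.linear[OF bounded_linear_cendo]]
  linear_0[OF bounded_linear.linear[OF bounded_linear_cendo]]

lemma inner_complexify_mat:
  "inner (complexify_mat A *v z) w = inner z (complexify_mat (transpose A) *v w)"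
proof -
  have "inner (complexify_mat A *v z) w = (\<Sum>i\<in>UNIV. \<Sum>j\<in>UNIV. A $ i $ j * inner (z $ j) (w $ i))"
    by (simp add: inner_vec_def matrix_vector_mult_def complexify_mat_def inner_sum_left
        scaleR_conv_of_real[symmetric])
  also have "\<dots> = (\<Sum>j\<in>UNIV. \<Sum>i\<in>UNIV. A $ i $ j * inner (z $ j) (w $ i))"
    by (rule sum.swap)
  also have "\<dots> = inner z (complexify_mat (transpose A) *v w)"
    by (simp add: inner_vec_def matrix_vector_mult_def complexify_mat_def inner_sum_right transpose_def
        scaleR_conv_of_real[symmetric])
  finally show ?thesis .
qed

lemma inner_complexify_orthogonal:
  assumes "orthogonal_matrix k"
  shows "inner (complexify_mat k *v z) (complexify_mat k *v w) = inner z w"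
  using assms by (simp add: inner_complexify_mat matrix_vector_mul_assoc complexify_mat_mult[symmetric] orthogonal_matrix)

lemma norm_complexify_orthogonal:
  "orthogonal_matrix k \<Longrightarrow> norm (complexify_mat k *v z) = norm z"
  by (simp add: norm_eq_sqrt_inner inner_complexify_orthogonal)

text \<open>Conjugation sits on the second argument, so that \<open>\<lambda>z. herm z v\<close> is
  a polynomial in \<open>z\<close> and can be used in test functions.\<close>

definition herm :: "complex^'n \<Rightarrow> complex^'n \<Rightarrow> complex" where
  "herm z w = (\<Sum>i\<in>UNIV. z $ i * cnj (w $ i))"

lemma Re_herm: "Re (herm z w) = inner z w"
  by (simp add: herm_def inner_vec_def inner_complex_def)

lemma Im_herm: "Im (herm z w) = inner z (\<i> *s w)"
  by (simp add: herm_def inner_vec_def inner_complex_def algebra_simps)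

lemma norm_i_mult [simp]: "norm (\<i> *s (w::complex^'n)) = norm w"
  by (simp add: norm_vec_def norm_mult)

lemma inner_i_mult_self [simp]: "inner z (\<i> *s z) = 0"
  by (simp add: inner_vec_def inner_complex_def)

lemma matrix_vector_mult_i: "(A::complex^'n^'n) *v (\<i> *s w) = \<i> *s (A *v w)"
  by (simp add: vec_eq_iff matrix_vector_mult_def sum_distrib_left mult.left_commute)

section \<open>The Lie algebra of \<open>K\<close> and the phase of \<open>herm (k v) v\<close> near
  a zero of the moment map\<close>

locale closed_orthogonal_group =
  fixes K :: "(real^'n^'n) set"
  assumes subgroup: "subgroup K orthogonal_group" and closed: "closed K"
begin

lemma orthogonal: "k \<in> K \<Longrightarrow> orthogonal_matrix k"
  using subgroup.subset[OF subgroup] by (auto simp: orthogonal_group_def)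

lemma one_mem: "mat 1 \<in> K"
  using subgroup.one_closed[OF subgroup] by (simp add: orthogonal_group_def)

lemma mult_mem: "k \<in> K \<Longrightarrow> h \<in> K \<Longrightarrow> k ** h \<in> K"
  using subgroup.m_closed[OF subgroup] by (simp add: orthogonal_group_def)

lemma transpose_mult: "k \<in> K \<Longrightarrow> transpose k ** k = mat 1" "k \<in> K \<Longrightarrow> k ** transpose k = mat 1"
  using orthogonal by (auto simp: orthogonal_matrix_def)

lemma transpose_mem:
  assumes "k \<in> K"
  shows "transpose k \<in> K"
proof -
  have "inv\<^bsub>orthogonal_group\<^esub> k = transpose k"
    using assms orthogonal[OF assms]
    by (intro group.inv_equality[OF group_orthogonal_group])
       (auto simp: orthogonal_group_def orthogonal_matrix_def)
  then show ?thesis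
    using subgroup.m_inv_closed[OF subgroup assms] by simp
qed

lemma norm_endo_of_matrix_le:
  assumes "k \<in> K"
  shows "norm (endo_of_matrix k) \<le> 1"
proof -
  have "orthogonal_transformation ((*v) k)"
    using orthogonal[OF assms] by (simp add: orthogonal_transformation_matrix)
  then show ?thesis
    by (intro norm_endo_le) (simp_all add: orthogonal_transformation_norm)
qed

lemma compact: "compact K"
proof -
  obtain B where "\<And>E :: (real^'n) endo. norm (matrix_of_endo E) \<le> norm E * B" and B: "B \<ge> 0"
    using bounded_linear.nonneg_bounded[OF bounded_linear_matrix_of_endo] by metis
  from this(1)[of "endo_of_matrix _"] have b: "norm k \<le> norm (endo_of_matrix k) * B" for k :: "real^'n^'n"
    by simp
  have "norm k \<le> 1 * B" if "k \<in> K" for k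
    using b[of k] mult_right_mono[OF norm_endo_of_matrix_le[OF that] B] by linarith
  then have "bounded K"
    by (auto simp: bounded_iff)
  with closed show ?thesis
    by (simp add: compact_eq_bounded_closed)
qed

sublocale endo_group: closed_contraction_group "endo_of_matrix ` K"
proof
  have "compact (endo_of_matrix ` K)"
    by (intro compact_continuous_image compact linear_continuous_on bounded_linear_endo_of_matrix)
  then show "closed (endo_of_matrix ` K)"
    by (rule compact_imp_closed)
  show "1 \<in> endo_of_matrix ` K"
    using one_mem by (auto intro!: image_eqI[of _ _ "mat 1"])
  show "x * y \<in> endo_of_matrix ` K" if "x \<in> endo_of_matrix ` K" "y \<in> endo_of_matrix ` K" for x y
    using that mult_mem by (auto simp: endo_of_matrix_mult[symmetric])
  show "\<exists>y\<in>endo_of_matrix ` K. x * y = 1" if x: "x \<in> endo_of_matrix ` K" for x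
  proof -
    obtain k where "k \<in> K" "x = endo_of_matrix k"
      using x by blast
    then show ?thesis
      using transpose_mem transpose_mult(2)
      by (auto intro!: bexI[of _ "transpose k"] simp: endo_of_matrix_mult[symmetric])
  qed
  show "norm x \<le> 1" if "x \<in> endo_of_matrix ` K" for x
    using that norm_endo_of_matrix_le by auto
qed

lemma lie_algebra_iff: "X \<in> lie_algebra K \<longleftrightarrow> endo_of_matrix X \<in> endo_group.lie"
proof -
  have "exp (t *\<^sub>R endo_of_matrix X) \<in> endo_of_matrix ` K \<longleftrightarrow> mat_exp (t *\<^sub>R X) \<in> K" for t
    by (auto simp: endo_of_matrix_linear_simps[symmetric] mat_exp_sums(2)[symmetric] endo_of_matrix_inject)
  then show ?thesis
    by (simp add: lie_algebra_def endo_group.lie_def)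
qed

lemma lie_algebra_scaleR: "X \<in> lie_algebra K \<Longrightarrow> c *\<^sub>R X \<in> lie_algebra K"
  by (simp add: lie_algebra_def)

lemma lie_algebra_zero: "0 \<in> lie_algebra K"
  by (simp add: lie_algebra_def one_mem)

lemma mat_exp_onto_neighbourhood:
  assumes \<epsilon>: "\<epsilon> > 0"
  shows "\<exists>\<delta>>0. \<forall>k\<in>K. norm (k - mat 1) < \<delta> \<longrightarrow>
    (\<exists>X\<in>lie_algebra K. norm (cendo X) < \<epsilon> \<and> mat_exp X = k)"
proof -
  obtain B where B: "\<And>E :: (real^'n) endo. norm (cendo (matrix_of_endo E)) \<le> norm E * B" "B > 0"
    using bounded_linear.pos_bounded[OF bounded_linear_compose[OF bounded_linear_cendo bounded_linear_matrix_of_endo]]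
    by metis
  obtain \<delta> where \<delta>: "\<delta> > 0" and cov: "\<And>k. k \<in> K \<Longrightarrow> norm (endo_of_matrix k - 1) < \<delta> \<Longrightarrow>
      \<exists>X\<in>endo_group.lie. norm X < \<epsilon> / B \<and> exp X = endo_of_matrix k"
    using endo_group.exp_onto_neighbourhood[of "\<epsilon> / B"] \<epsilon> B by auto
  obtain C where C: "\<And>A :: real^'n^'n. norm (endo_of_matrix A) \<le> norm A * C" "C > 0"
    using bounded_linear.pos_bounded[OF bounded_linear_endo_of_matrix] by metis
  have "\<exists>X\<in>lie_algebra K. norm (cendo X) < \<epsilon> \<and> mat_exp X = k"
    if k: "k \<in> K" "norm (k - mat 1) < \<delta> / C" for k
  proof -
    have "norm (endo_of_matrix k - 1) = norm (endo_of_matrix (k - mat 1))"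
      by (simp add: linear_diff[OF bounded_linear.linear[OF bounded_linear_endo_of_matrix]])
    also have "\<dots> \<le> norm (k - mat 1) * C"
      by (rule C)
    also have "\<dots> < \<delta>"
      using k C by (simp add: field_simps)
    finally obtain E where E: "E \<in> endo_group.lie" "norm E < \<epsilon> / B" "exp E = endo_of_matrix k"
      using cov k by blast
    have "norm (cendo (matrix_of_endo E)) < \<epsilon>"
      using B(1)[of E] E(2) B(2) by (simp add: field_simps)
    moreover have "mat_exp (matrix_of_endo E) = k"
      using E(3) by (metis endo_of_matrix_inject endo_of_matrix_of_endo mat_exp_sums(2))
    ultimately show ?thesis
      using E(1) by (intro bexI[of _ "matrix_of_endo E"]) (simp_all add: lie_algebra_iff endo_of_matrix_of_endo)
  qed
  then show ?thesis
    using \<delta> C by (intro exI[of _ "\<delta> / C"]) auto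
qed

text \<open>Differentiate \<open>inner (exp (t X) z) (exp (t X) w)\<close> at \<open>t = 0\<close>;
  it is constant because the one-parameter group is orthogonal.\<close>

lemma skew:
  assumes X: "X \<in> lie_algebra K"
  shows "inner (complexify_mat X *v z) w = - inner z (complexify_mat X *v w)"
proof -
  define f where "f t y = endo_apply (exp (t *\<^sub>R cendo X)) y" for t :: real and y
  have f: "f t y = complexify_mat (mat_exp (t *\<^sub>R X)) *v y" for t y
    by (simp add: f_def cendo_linear_simps[symmetric] cendo_exp[symmetric])
  have df: "((\<lambda>t. f t y) has_vector_derivative complexify_mat X *v y) (at 0)" for y
  proof -
    have "((\<lambda>t. exp (t *\<^sub>R cendo X)) has_vector_derivative exp (0 *\<^sub>R cendo X) * cendo X) (at 0)"
      by (rule exp_scaleR_has_vector_derivative_right)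
    from bounded_linear.has_vector_derivative[OF endo_apply.bounded_linear_left[of y] this]
    show ?thesis
      by (simp add: f_def)
  qed
  have "((\<lambda>t. inner (f t z) (f t w)) has_vector_derivative
      inner (f 0 z) (complexify_mat X *v w) + inner (complexify_mat X *v z) (f 0 w)) (at 0)"
    by (rule bounded_bilinear.has_vector_derivative[OF bounded_bilinear_inner df df])
  moreover have "inner (f t z) (f t w) = inner z w" for t
    unfolding f using X by (intro inner_complexify_orthogonal orthogonal) (auto simp: lie_algebra_def)
  ultimately have "((\<lambda>t. inner z w) has_vector_derivative
      inner (f 0 z) (complexify_mat X *v w) + inner (complexify_mat X *v z) (f 0 w)) (at 0)"
    by simp
  then have "inner (f 0 z) (complexify_mat X *v w) + inner (complexify_mat X *v z) (f 0 w) = 0"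
    using vector_derivative_unique_at has_vector_derivative_const by blast
  then show ?thesis
    by (simp add: f_def)
qed

text \<open>In the expansion of \<open>herm (exp X v) v\<close> the linear term vanishes by hypothesis, the
  quadratic term is real because \<open>X\<close> is skew, and the rest is cubic.\<close>

lemma imag_part_exp_le:
  assumes X: "X \<in> lie_algebra K" and small: "norm (cendo X) \<le> 1 / 4"
    and moment: "inner (complexify_mat X *v v) (\<i> *s v) = 0"
  shows "\<bar>Im (herm (complexify_mat (mat_exp X) *v v) v)\<bar>
    \<le> 12 * norm (cendo X) * (norm (complexify_mat (mat_exp X) *v v - v))\<^sup>2"
proof -
  define E where "E = cendo X"
  define a where "a = endo_apply E v"
  define D where "D = complexify_mat (mat_exp X) *v v - v"
  have E: "endo_apply E z = complexify_mat X *v z" for z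
    by (simp add: E_def)
  have skewE: "inner (endo_apply E z) w = - inner z (endo_apply E w)" for z w
    unfolding E by (rule skew[OF X])
  have Ei: "endo_apply E (\<i> *s z) = \<i> *s endo_apply E z" for z
    unfolding E by (rule matrix_vector_mult_i)
  obtain Q where Q: "exp E = 1 + E + (1/2) *\<^sub>R E\<^sup>2 + E * Q * E\<^sup>2" "norm Q \<le> exp (norm E)"
    by (rule exp_quadratic_remainder)
  have "exp (norm E) \<le> exp 1"
    using small by (simp add: E_def)
  then have Q3: "norm Q \<le> 3"
    using Q(2) exp_le by linarith
  have expv: "complexify_mat (mat_exp X) *v v
      = v + a + (1/2) *\<^sub>R endo_apply E a + endo_apply E (endo_apply Q (endo_apply E a))"
  proof -
    have "complexify_mat (mat_exp X) *v v = endo_apply (exp E) v"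
      by (simp add: E_def cendo_exp[symmetric])
    then show ?thesis
      by (simp add: Q(1) endo_apply.add_left endo_apply.scaleR_left a_def power2_eq_square)
  qed
  have Ea: "norm (endo_apply E a) \<le> norm E * norm a"
    by (rule norm_endo_apply)
  have QEa: "norm (endo_apply Q (endo_apply E a)) \<le> 3 * (norm E * norm a)"
    using norm_endo_apply[of Q "endo_apply E a"] mult_mono[OF Q3 Ea] by simp
  have "Im (herm (complexify_mat (mat_exp X) *v v) v) = - inner (endo_apply Q (endo_apply E a)) (\<i> *s a)"
    unfolding Im_herm expv inner_add_left inner_scaleR_left skewE[of a] skewE[of "endo_apply Q _"] Ei
    using moment by (simp add: a_def E)
  also have "\<bar>\<dots>\<bar> \<le> norm (endo_apply Q (endo_apply E a)) * norm a"
    using Cauchy_Schwarz_ineq2[of "endo_apply Q (endo_apply E a)" "\<i> *s a"] by simp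
  also have "\<dots> \<le> 3 * (norm E * norm a) * norm a"
    by (intro mult_right_mono QEa) simp
  finally have im: "\<bar>Im (herm (complexify_mat (mat_exp X) *v v) v)\<bar> \<le> 3 * norm E * (norm a)\<^sup>2"
    by (simp add: power2_eq_square mult.assoc)
  \<comment> \<open>The displacement is \<open>D = a + b\<close>. Smallness of
    \<open>cendo X\<close> makes \<open>b\<close> at most half as long as \<open>a\<close>, so
    \<open>norm a \<le> 2 * norm D\<close>; squaring this turns the factor 3 into 12.\<close>
  define b where "b = (1/2) *\<^sub>R endo_apply E a + endo_apply E (endo_apply Q (endo_apply E a))"
  have "norm b \<le> 1 / 2 * (norm E * norm a) + norm E * (3 * (norm E * norm a))"
    using Ea mult_left_mono[OF QEa norm_ge_zero[of E]]
    unfolding b_def by (intro norm_triangle_le add_mono order_trans[OF norm_endo_apply]) auto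
  also have "\<dots> \<le> 1 / 2 * (1 / 4 * norm a) + 1 / 4 * (3 * (1 / 4 * norm a))"
    using small by (intro add_mono mult_mono) (auto simp: E_def)
  also have "\<dots> \<le> 1 / 2 * norm a"
    by simp
  finally have "norm b \<le> 1 / 2 * norm a" .
  moreover have "D = a + b"
    by (simp add: D_def b_def expv)
  ultimately have "norm a \<le> 2 * norm D"
    using norm_triangle_ineq4[of D b] by simp
  then have "(norm a)\<^sup>2 \<le> (2 * norm D)\<^sup>2"
    by (intro power_mono) auto
  then have "3 * norm E * (norm a)\<^sup>2 \<le> 3 * norm E * (4 * (norm D)\<^sup>2)"
    by (intro mult_left_mono) (auto simp: power_mult_distrib)
  with im show ?thesis
    by (simp add: E_def D_def)
qed

text \<open>\<open>imag_part_exp_le\<close> reaches only \<open>k\<close> near 1, whereas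
  \<open>k v\<close> near \<open>v\<close> puts \<open>k\<close> merely near the stabilizer of
  \<open>v\<close>. By compactness, counterexamples accumulate at some \<open>s\<close> fixing
  \<open>v\<close>; then \<open>k ** transpose s\<close> is near 1 and moves \<open>v\<close> to the
  same point as \<open>k\<close>.\<close>

lemma imag_part_small:
  assumes moment: "\<And>X. X \<in> lie_algebra K \<Longrightarrow> inner (complexify_mat X *v v) (\<i> *s v) = 0"
    and \<epsilon>: "\<epsilon> > 0"
  shows "\<exists>\<delta>>0. \<forall>k\<in>K. norm (complexify_mat k *v v - v) < \<delta> \<longrightarrow>
    \<bar>Im (herm (complexify_mat k *v v) v)\<bar> \<le> \<epsilon> * (norm (complexify_mat k *v v - v))\<^sup>2"
proof (rule ccontr)
  let ?c = "\<lambda>k. complexify_mat k *v v"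
  let ?P = "\<lambda>k. \<bar>Im (herm (?c k) v)\<bar> \<le> \<epsilon> * (norm (?c k - v))\<^sup>2"
  assume "\<not> ?thesis"
  then have "\<forall>n. \<exists>k\<in>K. norm (?c k - v) < 1 / real (Suc n) \<and> \<not> ?P k"
    by (metis of_nat_0_less_iff zero_less_Suc zero_less_divide_1_iff)
  then obtain k where kK: "\<And>n. k n \<in> K" and kn: "\<And>n. norm (?c (k n) - v) < 1 / real (Suc n)"
    and bad: "\<And>n. \<not> ?P (k n)"
    by metis
  obtain s \<sigma> where s: "s \<in> K" and \<sigma>: "strict_mono \<sigma>" and lim: "(k \<circ> \<sigma>) \<longlonglongrightarrow> s"
    using compact kK unfolding compact_def by blast
  have cont: "((\<lambda>n. complexify_mat (f n) *v v) \<longlongrightarrow> complexify_mat l *v v) F"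
    if "(f \<longlongrightarrow> l) F" for f :: "nat \<Rightarrow> real^'n^'n" and l F
  proof -
    have "((\<lambda>n. endo_apply (cendo (f n)) v) \<longlongrightarrow> endo_apply (cendo l) v) F"
      by (intro endo_apply.tendsto tendsto_const bounded_linear.tendsto[OF bounded_linear_cendo] that)
    then show ?thesis by simp
  qed
  have "(\<lambda>n. norm (?c (k n) - v)) \<longlonglongrightarrow> 0"
    by (rule tendsto_sandwich[OF _ _ tendsto_const LIMSEQ_Suc[OF lim_1_over_n]])
       (use kn in \<open>auto intro!: always_eventually less_imp_le\<close>)
  then have "(\<lambda>n. ?c (k n)) \<longlonglongrightarrow> v"
    by (simp add: tendsto_norm_zero_iff LIM_zero_iff)
  then have "(\<lambda>n. ?c (k (\<sigma> n))) \<longlonglongrightarrow> v"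
    using LIMSEQ_subseq_LIMSEQ[OF _ \<sigma>] by (force simp: o_def)
  moreover have "(\<lambda>n. ?c (k (\<sigma> n))) \<longlonglongrightarrow> ?c s"
    using cont[OF lim] by (simp add: o_def)
  ultimately have sv: "?c s = v"
    using LIMSEQ_unique by blast
  have sT: "complexify_mat (transpose s) *v v = v"
  proof -
    have "complexify_mat (transpose s) *v ?c s = v"
      by (simp add: matrix_vector_mul_assoc complexify_mat_mult[symmetric] transpose_mult[OF s])
    then show ?thesis by (simp add: sv)
  qed
  define h where "h n = k (\<sigma> n) ** transpose s" for n
  have hK: "h n \<in> K" for n
    unfolding h_def by (intro mult_mem kK transpose_mem s)
  have hv: "?c (h n) = ?c (k (\<sigma> n))" for n
    by (simp add: h_def complexify_mat_mult matrix_vector_mul_assoc[symmetric] sT)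
  \<comment> \<open>Here \<open>1/4\<close> is the smallness hypothesis of
    \<open>imag_part_exp_le\<close> and 12 its constant.\<close>
  define \<eta> where "\<eta> = min (1/4) (\<epsilon> / 12)"
  have \<eta>: "\<eta> > 0" using \<epsilon> by (simp add: \<eta>_def)
  obtain \<delta> where \<delta>: "\<delta> > 0" and cov: "\<And>k. k \<in> K \<Longrightarrow> norm (k - mat 1) < \<delta> \<Longrightarrow>
      \<exists>X\<in>lie_algebra K. norm (cendo X) < \<eta> \<and> mat_exp X = k"
    using mat_exp_onto_neighbourhood[OF \<eta>] by blast
  have "h \<longlonglongrightarrow> s ** transpose s"
    unfolding h_def using lim
    by (intro bounded_linear.tendsto[of "\<lambda>A. A ** transpose s"])
       (simp_all add: o_def linear_conv_bounded_linear[symmetric] linear_iff vec_eq_iff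
          matrix_matrix_mult_def sum.distrib distrib_right sum_distrib_left mult.assoc)
  then have "h \<longlonglongrightarrow> mat 1"
    by (simp add: transpose_mult(2)[OF s])
  then have "\<forall>\<^sub>F n in sequentially. norm (h n - mat 1) < \<delta>"
    using \<delta> by (auto dest!: tendstoD simp: dist_norm)
  then obtain n where n: "norm (h n - mat 1) < \<delta>"
    using eventually_happens'[OF sequentially_bot] by blast
  obtain X where X: "X \<in> lie_algebra K" "norm (cendo X) < \<eta>" "mat_exp X = h n"
    using cov[OF hK n] by blast
  have "\<bar>Im (herm (?c (h n)) v)\<bar> \<le> 12 * norm (cendo X) * (norm (?c (h n) - v))\<^sup>2"
    using imag_part_exp_le[OF X(1) _ moment[OF X(1)]] X by (simp add: \<eta>_def)
  also have "\<dots> \<le> \<epsilon> * (norm (?c (h n) - v))\<^sup>2"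
    using X(2) by (intro mult_right_mono) (auto simp: \<eta>_def)
  finally have "?P (k (\<sigma> n))"
    by (simp add: hv)
  with bad show False by blast
qed

end

section \<open>Polynomials and the complexified group\<close>

text \<open>A form of polynomials made for structural induction. The way back to the normal form
  \<open>complex_polynomial\<close> is taken only for averages, through
  \<open>coeff_family\<close>.\<close>

inductive polyfun :: "(complex^'n \<Rightarrow> complex) \<Rightarrow> bool" where
  const: "polyfun (\<lambda>_. c)"
| coord: "polyfun (\<lambda>z. z $ i)"
| add: "polyfun p \<Longrightarrow> polyfun q \<Longrightarrow> polyfun (\<lambda>z. p z + q z)"
| mult: "polyfun p \<Longrightarrow> polyfun q \<Longrightarrow> polyfun (\<lambda>z. p z * q z)"

lemma polyfun_sum: "(\<And>j. j \<in> J \<Longrightarrow> polyfun (f j)) \<Longrightarrow> polyfun (\<lambda>z. \<Sum>j\<in>J. f j z)"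
  by (induction J rule: infinite_finite_induct) (auto intro: polyfun.intros)

lemma polyfun_prod: "(\<And>j. j \<in> J \<Longrightarrow> polyfun (f j)) \<Longrightarrow> polyfun (\<lambda>z. \<Prod>j\<in>J. f j z)"
  by (induction J rule: infinite_finite_induct) (auto intro: polyfun.intros)

lemma polyfun_power: "polyfun f \<Longrightarrow> polyfun (\<lambda>z. f z ^ m)"
  by (induction m) (auto intro: polyfun.intros)

lemma complex_polynomial_polyfun:
  assumes "complex_polynomial p"
  shows "polyfun p"
proof -
  obtain S c where p: "p = (\<lambda>z. \<Sum>\<alpha>\<in>S. c \<alpha> * (\<Prod>i\<in>UNIV. (z $ i) ^ \<alpha> i))"
    using assms unfolding complex_polynomial_def by blast
  show ?thesis
    unfolding p by (intro polyfun_sum polyfun.mult polyfun.const polyfun_prod polyfun_power polyfun.coord)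
qed

lemma polyfun_continuous: "polyfun p \<Longrightarrow> continuous_on S p"
  by (induction rule: polyfun.induct) (auto intro!: continuous_intros)

text \<open>A real derivative that commutes with \<open>\<i>\<close> is complex linear. This carries
  vanishing in the directions \<open>X z\<close> and \<open>Y z\<close> over to
  \<open>X z + \<i> Y z\<close>.\<close>

lemma polyfun_derivative:
  assumes "polyfun p"
  shows "\<exists>D. (p has_derivative D) (at z) \<and> (\<forall>w. D (\<i> *s w) = \<i> * D w)"
  using assms
proof induction
  case (const c)
  then show ?case by (intro exI[of _ "\<lambda>_. 0"]) auto
next
  case (coord i)
  then show ?case
    by (intro exI[of _ "\<lambda>w. w $ i"] conjI bounded_linear_imp_has_derivative bounded_linear_vec_nth) simp
next
  case (add p q)
  then obtain D E where "(p has_derivative D) (at z)" "(q has_derivative E) (at z)"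
    "\<forall>w. D (\<i> *s w) = \<i> * D w" "\<forall>w. E (\<i> *s w) = \<i> * E w" by blast
  then show ?case
    by (intro exI[of _ "\<lambda>w. D w + E w"]) (auto intro!: derivative_eq_intros simp: algebra_simps)
next
  case (mult p q)
  then obtain D E where "(p has_derivative D) (at z)" "(q has_derivative E) (at z)"
    "\<forall>w. D (\<i> *s w) = \<i> * D w" "\<forall>w. E (\<i> *s w) = \<i> * E w" by blast
  moreover from this have "((\<lambda>z. p z * q z) has_derivative (\<lambda>w. p z * E w + D w * q z)) (at z)"
    by (intro has_derivative_mult)
  ultimately show ?case
    by (intro exI[of _ "\<lambda>w. p z * E w + D w * q z"]) (simp add: algebra_simps)
qed

lemma has_vector_derivative_compose_derivative:
  assumes "(f has_vector_derivative v) (at t)" and "(p has_derivative D) (at (f t))"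
  shows "(p \<circ> f has_vector_derivative D v) (at t)"
  using has_derivative_compose[OF assms(1)[unfolded has_vector_derivative_def] assms(2)]
    linear_scale[OF has_derivative_linear[OF assms(2)]]
  by (simp add: has_vector_derivative_def o_def)

lemma exp_conjugate:
  fixes a b E :: "'a::{real_normed_algebra_1,banach}"
  assumes ab: "a * b = 1" and ba: "b * a = 1"
  shows "exp (a * E * b) = a * exp E * b"
proof -
  have "(a * E * b) ^ n = a * E ^ n * b" for n
  proof (induction n)
    case (Suc n)
    have "(a * E * b) ^ Suc n = a * E * (b * a) * E ^ n * b"
      by (simp only: power_Suc Suc) (simp only: mult.assoc)
    then show ?case by (simp only: ba mult_1_right power_Suc mult.assoc)
  qed (simp add: ab)
  moreover have "(\<lambda>n. a * (E ^ n /\<^sub>R fact n) * b) sums (a * exp E * b)"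
    by (intro sums_mult sums_mult2 exp_converges)
  ultimately have "(\<lambda>n. (a * E * b) ^ n /\<^sub>R fact n) sums (a * exp E * b)"
    by simp
  then show ?thesis
    using exp_converges sums_unique2 by blast
qed

lemma mat_exp_conjugate:
  fixes A B X :: "'a::{real_normed_field,euclidean_space}^'n^'n"
  assumes "A ** B = mat 1" "B ** A = mat 1"
  shows "mat_exp (A ** X ** B) = A ** mat_exp X ** B"
proof -
  have "endo_of_matrix A * endo_of_matrix B = 1" "endo_of_matrix B * endo_of_matrix A = 1"
    using assms by (metis endo_of_matrix_mult endo_of_matrix_one)+
  from exp_conjugate[OF this, of "endo_of_matrix X"] show ?thesis
    by (simp add: endo_of_matrix_inject[symmetric] mat_exp_sums endo_of_matrix_mult)
qed

lemma mat_exp_invertible: "invertible (mat_exp (X :: 'a::{real_normed_field,euclidean_space}^'n^'n))"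
proof -
  have "mat_exp X ** mat_exp (- X) = mat 1" "mat_exp (- X) ** mat_exp X = mat 1"
    using exp_minus_inverse[of "endo_of_matrix X"] exp_minus_inverse[of "endo_of_matrix (- X)"]
    by (simp_all add: endo_of_matrix_inject[symmetric] mat_exp_sums endo_of_matrix_mult
        linear_neg[OF bounded_linear.linear[OF bounded_linear_endo_of_matrix]])
  then show ?thesis
    by (auto simp: invertible_def)
qed

lemma exp_orbit_derivative:
  "((\<lambda>t. endo_apply (exp (t *\<^sub>R E)) z) has_vector_derivative endo_apply E (endo_apply (exp (t *\<^sub>R E)) z)) (at t)"
  using bounded_linear.has_vector_derivative[OF endo_apply.bounded_linear_left[of z] exp_scaleR_has_vector_derivative_left]
  by simp

lemma mat_exp_scaleR_apply:
  "mat_exp (t *\<^sub>R Z) *v z = endo_apply (exp (t *\<^sub>R endo_of_matrix Z)) z"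
proof -
  have "exp (t *\<^sub>R endo_of_matrix Z) = endo_of_matrix (mat_exp (t *\<^sub>R Z))"
    by (simp add: mat_exp_sums endo_of_matrix_linear_simps)
  then show ?thesis by simp
qed

definition complex_mat :: "real^'n^'n \<Rightarrow> real^'n^'n \<Rightarrow> complex^'n^'n" where
  "complex_mat X Y = (\<chi> i j. Complex (X $ i $ j) (Y $ i $ j))"

lemma complex_mat_mult_vec:
  "complex_mat X Y *v z = complexify_mat X *v z + \<i> *s (complexify_mat Y *v z)"
  by (simp add: complex_mat_def complexify_mat_def vec_eq_iff matrix_vector_mult_def Complex_eq
      algebra_simps sum.distrib sum_distrib_left)

lemma complex_mat_scaleR: "c *\<^sub>R complex_mat X Y = complex_mat (c *\<^sub>R X) (c *\<^sub>R Y)"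
  by (simp add: complex_mat_def vec_eq_iff complex_eq_iff)

lemma complex_mat_conjugate:
  "complexify_mat A ** complex_mat X Y ** complexify_mat B = complex_mat (A ** X ** B) (A ** Y ** B)"
  by (simp add: complex_mat_def complexify_mat_def vec_eq_iff matrix_matrix_mult_def complex_eq_iff sum_distrib_right)

section \<open>Invariance under the complexified group, orbit closures and minimal vectors\<close>

context closed_orthogonal_group
begin

abbreviation "L\<^sub>C \<equiv> complexified_lie_algebra K"
abbreviation "K\<^sub>C \<equiv> complexification K"

lemma complexified_lie_algebra_eq:
  "L\<^sub>C = {complex_mat X Y | X Y. X \<in> lie_algebra K \<and> Y \<in> lie_algebra K}"
  by (simp add: complexified_lie_algebra_def complex_mat_def)

text \<open>Invariance under \<open>K\<close> makes the derivative of \<open>p\<close> vanish in the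
  directions \<open>X z\<close> at every point \<open>z\<close>. So \<open>p\<close> has derivative
  0 along the whole curve \<open>exp (t Z) z\<close>, not only at its start, and is constant on
  it.\<close>

lemma polyfun_exp_invariant:
  assumes p: "polyfun p" and inv: "\<And>k z. k \<in> K \<Longrightarrow> p (complexify_mat k *v z) = p z"
    and Z: "Z \<in> L\<^sub>C"
  shows "p (mat_exp Z *v z) = p z"
proof -
  obtain X Y where Z: "Z = complex_mat X Y" "X \<in> lie_algebra K" "Y \<in> lie_algebra K"
    using Z by (auto simp: complexified_lie_algebra_eq)
  obtain D where D: "\<And>z. (p has_derivative D z) (at z)" "\<And>z w. D z (\<i> *s w) = \<i> * D z w"
    using polyfun_derivative[OF p] by metis
  have D0: "D z (complexify_mat X *v z) = 0" if X: "X \<in> lie_algebra K" for X z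
  proof -
    define f where "f = (\<lambda>t::real. endo_apply (exp (t *\<^sub>R cendo X)) z)"
    have f0: "f 0 = z"
      by (simp add: f_def)
    have "(f has_vector_derivative complexify_mat X *v z) (at 0)"
      using exp_orbit_derivative[of "cendo X" z 0] by (simp add: f_def)
    then have "(p \<circ> f has_vector_derivative D z (complexify_mat X *v z)) (at 0)"
      using D(1)[of z] f0 by (intro has_vector_derivative_compose_derivative) auto
    moreover have "p \<circ> f = (\<lambda>t. p z)"
    proof
      fix t
      have "f t = complexify_mat (mat_exp (t *\<^sub>R X)) *v z"
        by (simp add: f_def cendo_linear_simps[symmetric] cendo_exp[symmetric])
      then show "(p \<circ> f) t = p z"
        using X by (simp add: lie_algebra_def inv)
    qed
    ultimately show ?thesis
      by (metis vector_derivative_unique_at has_vector_derivative_const)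
  qed
  define f where "f = (\<lambda>t::real. endo_apply (exp (t *\<^sub>R endo_of_matrix Z)) z)"
  have "(p \<circ> f has_vector_derivative 0) (at t)" for t
  proof -
    have "(f has_vector_derivative Z *v f t) (at t)"
      using exp_orbit_derivative[of "endo_of_matrix Z" z t] by (simp add: f_def)
    then have "(p \<circ> f has_vector_derivative D (f t) (Z *v f t)) (at t)"
      using D(1)[of "f t"] by (rule has_vector_derivative_compose_derivative)
    also have "D (f t) (Z *v f t) = 0"
      using linear_add[OF has_derivative_linear[OF D(1)]] D0 Z by (simp add: complex_mat_mult_vec D(2))
    finally show ?thesis .
  qed
  then obtain c where "\<And>t. (p \<circ> f) t = c"
    using has_vector_derivative_zero_constant[of UNIV "p \<circ> f"] by auto
  from this[of 1] this[of 0] show ?thesis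
    using mat_exp_scaleR_apply[of 1 Z z] by (simp add: f_def)
qed

lemma polyfun_complexification_invariant:
  assumes p: "polyfun p" and inv: "\<And>k z. k \<in> K \<Longrightarrow> p (complexify_mat k *v z) = p z"
    and A: "A \<in> K\<^sub>C"
  shows "p (A *v z) = p z"
proof -
  have gen: "p (B *v z) = p z" if "B \<in> generate complex_GL (mat_exp ` L\<^sub>C)" for B z
    using that
  proof (induction arbitrary: z rule: generate.induct)
    case one
    then show ?case by (simp add: complex_GL_def)
  next
    case (incl h)
    then show ?case using polyfun_exp_invariant[OF p inv] by auto
  next
    case (inv h)
    then obtain Z where Z: "Z \<in> L\<^sub>C" "h = mat_exp Z" by blast
    have "h \<in> carrier complex_GL"
      by (simp add: Z complex_GL_def mat_exp_invertible)
    then have "h ** inv\<^bsub>complex_GL\<^esub> h = mat 1"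
      using group.r_inv[OF group_complex_GL] by (simp add: complex_GL_def)
    then have "h *v ((inv\<^bsub>complex_GL\<^esub> h) *v z) = z"
      by (simp add: matrix_vector_mul_assoc)
    then show ?case
      using polyfun_exp_invariant[OF p assms(2) Z(1), of "(inv\<^bsub>complex_GL\<^esub> h) *v z"] by (simp add: Z(2))
  next
    case (eng h1 h2)
    have "h1 \<otimes>\<^bsub>complex_GL\<^esub> h2 = h1 ** h2"
      by (simp add: complex_GL_def)
    then show ?case
      using eng.IH by (simp add: matrix_vector_mul_assoc[symmetric])
  qed
  obtain k B where "k \<in> K" "B \<in> generate complex_GL (mat_exp ` L\<^sub>C)" "A = complexify_mat k ** B"
    using A by (auto simp: complexification_def analytic_subgroup_def)
  then show ?thesis
    using gen inv by (simp add: matrix_vector_mul_assoc[symmetric])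
qed

lemma complexify_mem_complexification:
  assumes "k \<in> K"
  shows "complexify_mat k \<in> K\<^sub>C"
proof -
  have "mat 1 \<in> analytic_subgroup L\<^sub>C"
    using generate.one[of complex_GL] by (simp add: analytic_subgroup_def complex_GL_def)
  then show ?thesis
    using assms matrix_mul_rid[of "complexify_mat k"] unfolding complexification_def by force
qed

lemma complexify_mult_complexification:
  assumes "k \<in> K" "A \<in> K\<^sub>C"
  shows "complexify_mat k ** A \<in> K\<^sub>C"
proof -
  obtain h B where "h \<in> K" "B \<in> analytic_subgroup L\<^sub>C" "A = complexify_mat h ** B"
    using assms(2) by (auto simp: complexification_def)
  then show ?thesis
    using mult_mem[OF assms(1), of h] unfolding complexification_def
    by (auto simp: complexify_mat_mult matrix_mul_assoc intro!: exI[of _ "k ** h"] exI[of _ B])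
qed

lemma lie_algebra_conjugate:
  assumes X: "X \<in> lie_algebra K" and k: "k \<in> K"
  shows "transpose k ** X ** k \<in> lie_algebra K"
proof -
  have "mat_exp (t *\<^sub>R (transpose k ** X ** k)) = transpose k ** mat_exp (t *\<^sub>R X) ** k" for t
    using mat_exp_conjugate[OF transpose_mult[OF k], of "t *\<^sub>R X"]
    by (simp add: scalar_matrix_assoc matrix_scalar_ac)
  then show ?thesis
    using X k by (simp add: lie_algebra_def mult_mem transpose_mem)
qed

text \<open>Elements of \<open>K\<^sub>C\<close> carry their \<open>K\<close>-factor on the left, so
  the exponential has to pass it: \<open>exp Z k = k exp (k\<^sup>-\<^sup>1 Z k)\<close>, and
  conjugation by \<open>k\<close> preserves the Lie algebra.\<close>

lemma exp_mult_complexification: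
  assumes Z: "Z \<in> L\<^sub>C" and A: "A \<in> K\<^sub>C"
  shows "mat_exp Z ** A \<in> K\<^sub>C"
proof -
  obtain X Y where XY: "Z = complex_mat X Y" "X \<in> lie_algebra K" "Y \<in> lie_algebra K"
    using Z by (auto simp: complexified_lie_algebra_eq)
  obtain k B where k: "k \<in> K" and B: "B \<in> analytic_subgroup L\<^sub>C" and A: "A = complexify_mat k ** B"
    using A by (auto simp: complexification_def)
  define W where "W = complex_mat (transpose k ** X ** k) (transpose k ** Y ** k)"
  have W: "W \<in> L\<^sub>C"
    unfolding W_def complexified_lie_algebra_eq using XY lie_algebra_conjugate[OF _ k] by blast
  have kk: "complexify_mat k ** complexify_mat (transpose k) = mat 1"
    by (simp add: complexify_mat_mult[symmetric] transpose_mult[OF k])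
  have kk': "complexify_mat (transpose k) ** complexify_mat k = mat 1"
    by (simp add: complexify_mat_mult[symmetric] transpose_mult[OF k])
  have "mat_exp W = complexify_mat (transpose k) ** mat_exp Z ** complexify_mat k"
    unfolding W_def complex_mat_conjugate[symmetric] XY(1) by (rule mat_exp_conjugate[OF kk' kk])
  then have "complexify_mat k ** mat_exp W = (complexify_mat k ** complexify_mat (transpose k)) ** mat_exp Z ** complexify_mat k"
    by (simp add: matrix_mul_assoc)
  then have "mat_exp Z ** A = complexify_mat k ** (mat_exp W ** B)"
    by (simp add: A kk matrix_mul_assoc)
  moreover have "mat_exp W ** B \<in> analytic_subgroup L\<^sub>C"
    using generate.eng[OF generate.incl[of "mat_exp W" "mat_exp ` L\<^sub>C" complex_GL]] W B
    by (simp add: analytic_subgroup_def complex_GL_def)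
  ultimately show ?thesis
    using k unfolding complexification_def by blast
qed

lemma closure_orbit_mult:
  assumes stable: "\<And>A. A \<in> K\<^sub>C \<Longrightarrow> M ** A \<in> K\<^sub>C"
    and v: "v \<in> closure (matrix_orbit K\<^sub>C \<xi>)"
  shows "M *v v \<in> closure (matrix_orbit K\<^sub>C \<xi>)"
proof -
  have "continuous_on (closure (matrix_orbit K\<^sub>C \<xi>)) ((*v) M)"
    by (intro linear_continuous_on matrix_vector_mul_bounded_linear)
  then have "(*v) M ` closure (matrix_orbit K\<^sub>C \<xi>) \<subseteq> closure (matrix_orbit K\<^sub>C \<xi>)"
  proof (rule image_closure_subset)
    show "(*v) M ` matrix_orbit K\<^sub>C \<xi> \<subseteq> closure (matrix_orbit K\<^sub>C \<xi>)"
      using stable closure_subset by (fastforce simp: matrix_orbit_def matrix_vector_mul_assoc)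
  qed simp
  with v show ?thesis by blast
qed

lemma polyfun_closure_orbit:
  assumes p: "polyfun p" and inv: "\<And>k z. k \<in> K \<Longrightarrow> p (complexify_mat k *v z) = p z"
    and v: "v \<in> closure (matrix_orbit K\<^sub>C \<xi>)"
  shows "p v = p \<xi>"
proof -
  have "p ` closure (matrix_orbit K\<^sub>C \<xi>) \<subseteq> {p \<xi>}"
    by (rule image_closure_subset[OF polyfun_continuous[OF p]])
       (auto simp: matrix_orbit_def polyfun_complexification_invariant[OF p inv])
  with v show ?thesis by blast
qed

text \<open>The vector has minimal length in the orbit closure (Kempf-Ness); the second property says
  that the moment map of \<open>K\<close> vanishes at it.\<close>

lemma minimal_vector:
  obtains v where "v \<in> closure (matrix_orbit K\<^sub>C \<xi>)"
    and "\<And>X. X \<in> lie_algebra K \<Longrightarrow> inner (complexify_mat X *v v) (\<i> *s v) = 0"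
proof -
  have "\<xi> \<in> matrix_orbit K\<^sub>C \<xi>"
    using complexify_mem_complexification[OF one_mem] by (auto simp: matrix_orbit_def intro!: image_eqI[of _ _ "mat 1"])
  then have "closure (matrix_orbit K\<^sub>C \<xi>) \<noteq> {}"
    using closure_subset by blast
  then obtain v where v: "v \<in> closure (matrix_orbit K\<^sub>C \<xi>)"
    and min: "\<And>w. w \<in> closure (matrix_orbit K\<^sub>C \<xi>) \<Longrightarrow> dist 0 v \<le> dist 0 w"
    using distance_attains_inf[of "closure (matrix_orbit K\<^sub>C \<xi>)" 0] by auto
  have "inner (complexify_mat X *v v) (\<i> *s v) = 0" if X: "X \<in> lie_algebra K" for X
  proof -
    \<comment> \<open>Moving along \<open>exp (\<i> t X)\<close> stays in the orbit closure but may
      change lengths. The squared length is minimal at \<open>t = 0\<close>, and its derivative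
      there is \<open>- 2 * inner (X v) (\<i> v)\<close>.\<close>
    define Z where "Z = complex_mat 0 X"
    have tZ: "t *\<^sub>R Z \<in> L\<^sub>C" for t
      using lie_algebra_zero lie_algebra_scaleR[OF X] by (auto simp: Z_def complex_mat_scaleR complexified_lie_algebra_eq)
    define f where "f = (\<lambda>t::real. endo_apply (exp (t *\<^sub>R endo_of_matrix Z)) v)"
    have f0: "f 0 = v" by (simp add: f_def)
    have df: "(f has_vector_derivative Z *v v) (at 0)"
      using exp_orbit_derivative[of "endo_of_matrix Z" v 0] by (simp add: f_def)
    have "((\<lambda>t. inner (f t) (f t)) has_vector_derivative inner (f 0) (Z *v v) + inner (Z *v v) (f 0)) (at 0)"
      by (rule bounded_bilinear.has_vector_derivative[OF bounded_bilinear_inner df df])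
    then have "((\<lambda>t. inner (f t) (f t)) has_real_derivative 2 * inner (Z *v v) v) (at 0)"
      by (simp add: f0 has_real_derivative_iff_has_vector_derivative inner_commute)
    moreover have "inner (f 0) (f 0) \<le> inner (f t) (f t)" for t
    proof -
      have "f t \<in> closure (matrix_orbit K\<^sub>C \<xi>)"
        using closure_orbit_mult[OF exp_mult_complexification[OF tZ] v] by (simp add: f_def mat_exp_scaleR_apply)
      from min[OF this] show ?thesis
        by (simp add: f0 dot_square_norm)
    qed
    ultimately have "2 * inner (Z *v v) v = 0"
      by (intro DERIV_local_min[where d = 1]) auto
    moreover have "complexify_mat 0 *v v = 0"
      by (simp add: complexify_mat_linear_simps)
    then have "Z *v v = \<i> *s (complexify_mat X *v v)"
      by (simp add: Z_def complex_mat_mult_vec)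
    moreover have "inner (\<i> *s w) v = - inner w (\<i> *s v)" for w :: "complex^'n"
      by (simp add: inner_vec_def inner_complex_def sum_negf[symmetric] algebra_simps)
    ultimately show ?thesis by simp
  qed
  with v that show thesis by blast
qed

end

section \<open>Haar measure and averages\<close>

lemma monomial_mult: "(\<Prod>i\<in>UNIV. (z $ i) ^ \<alpha> i) * (\<Prod>i\<in>UNIV. (z $ i) ^ \<beta> i) = (\<Prod>i\<in>UNIV. ((z::complex^'n) $ i) ^ (\<alpha> i + \<beta> i))"
  by (simp add: prod.distrib power_add)

lemma complex_polynomial_monomial: "complex_polynomial (\<lambda>z. c * (\<Prod>i\<in>UNIV. (z $ i) ^ \<alpha> i))"
  unfolding complex_polynomial_def by (intro exI[of _ "{\<alpha>}"] exI[of _ "\<lambda>_. c"]) simp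

lemma complex_polynomial_add:
  assumes "complex_polynomial p" "complex_polynomial q"
  shows "complex_polynomial (\<lambda>z. p z + q z)"
proof -
  obtain S c where S: "finite S" "\<And>z. p z = (\<Sum>\<alpha>\<in>S. c \<alpha> * (\<Prod>i\<in>UNIV. (z $ i) ^ \<alpha> i))"
    using assms(1) unfolding complex_polynomial_def by blast
  obtain T d where T: "finite T" "\<And>z. q z = (\<Sum>\<alpha>\<in>T. d \<alpha> * (\<Prod>i\<in>UNIV. (z $ i) ^ \<alpha> i))"
    using assms(2) unfolding complex_polynomial_def by blast
  define c' where "c' \<alpha> = (if \<alpha> \<in> S then c \<alpha> else 0)" for \<alpha>
  define d' where "d' \<alpha> = (if \<alpha> \<in> T then d \<alpha> else 0)" for \<alpha>
  have "p z = (\<Sum>\<alpha>\<in>S \<union> T. c' \<alpha> * (\<Prod>i\<in>UNIV. (z $ i) ^ \<alpha> i))" for z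
    unfolding S(2) using S T by (intro sum.mono_neutral_cong_left) (auto simp: c'_def)
  moreover have "q z = (\<Sum>\<alpha>\<in>S \<union> T. d' \<alpha> * (\<Prod>i\<in>UNIV. (z $ i) ^ \<alpha> i))" for z
    unfolding T(2) using S T by (intro sum.mono_neutral_cong_left) (auto simp: d'_def)
  ultimately have "p z + q z = (\<Sum>\<alpha>\<in>S \<union> T. (c' \<alpha> + d' \<alpha>) * (\<Prod>i\<in>UNIV. (z $ i) ^ \<alpha> i))" for z
    by (simp add: sum.distrib distrib_right)
  then show ?thesis
    unfolding complex_polynomial_def using S T by (intro exI[of _ "S \<union> T"] exI[of _ "\<lambda>\<alpha>. c' \<alpha> + d' \<alpha>"]) auto
qed

section \<open>Invariance of the Haar measure and averaging of polynomials\<close>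

locale haar_group = closed_orthogonal_group K for K :: "(real^'n^'n) set" +
  fixes \<mu> :: "(real^'n^'n) measure"
  assumes haar: "normalized_haar_measure K \<mu>"
begin

lemma sets_haar: "sets \<mu> = sets (restrict_space borel K)"
  using haar by (simp add: normalized_haar_measure_def)

lemma space_haar: "space \<mu> = K"
  using sets_eq_imp_space_eq[OF sets_haar] by (simp add: space_restrict_space)

sublocale finite_measure \<mu>
  using haar by (intro finite_measureI) (simp add: normalized_haar_measure_def)

lemma measure_haar: "measure \<mu> K = 1"
  using haar by (simp add: normalized_haar_measure_def space_haar measure_def)

lemma measurable_haar: "continuous_on K f \<Longrightarrow> f \<in> borel_measurable \<mu>"
  using borel_measurable_continuous_on_restrict measurable_cong_sets[OF sets_haar refl] by blast

lemma measurable_into_haar: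
  assumes "f \<in> borel_measurable M" "\<And>x. x \<in> space M \<Longrightarrow> f x \<in> K"
  shows "f \<in> measurable M \<mu>"
  using measurable_restrict_space2[of f M K borel] assms measurable_cong_sets[OF refl sets_haar] by auto

lemma integrable_continuous:
  fixes f :: "real^'n^'n \<Rightarrow> complex"
  assumes "continuous_on K f"
  shows "integrable \<mu> f"
proof -
  have "bounded (f ` K)"
    by (intro compact_imp_bounded compact_continuous_image assms compact)
  then obtain B where "\<And>k. k \<in> K \<Longrightarrow> norm (f k) \<le> B"
    by (auto simp: bounded_iff)
  then show ?thesis
    by (intro integrable_const_bound[where B = B] measurable_haar assms AE_I2) (simp_all add: space_haar)
qed

lemma continuous_matrix_mult_left: "continuous_on S (\<lambda>k. h ** (k :: real^'n^'n))"
  by (intro linear_continuous_on)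
     (simp add: linear_conv_bounded_linear[symmetric] linear_iff vec_eq_iff
          matrix_matrix_mult_def sum.distrib distrib_left sum_distrib_left mult_ac)

lemma measurable_mult_left: "h \<in> K \<Longrightarrow> (\<lambda>k. h ** k) \<in> measurable \<mu> \<mu>"
  by (intro measurable_into_haar measurable_haar continuous_matrix_mult_left) (auto simp: space_haar mult_mem)

lemma distr_mult_left: "h \<in> K \<Longrightarrow> distr \<mu> \<mu> (\<lambda>k. h ** k) = \<mu>"
  using haar by (simp add: normalized_haar_measure_def)

lemma integral_mult_left:
  fixes f :: "real^'n^'n \<Rightarrow> complex"
  assumes "h \<in> K" "continuous_on K f"
  shows "(LINT k|\<mu>. f (h ** k)) = (LINT k|\<mu>. f k)"
  using integral_distr[OF measurable_mult_left[OF assms(1)] measurable_haar[OF assms(2)]]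
  by (simp add: distr_mult_left[OF assms(1)])

lemma measure_mult_left:
  assumes "h \<in> K" "A \<in> sets \<mu>"
  shows "measure \<mu> {k \<in> K. h ** k \<in> A} = measure \<mu> A"
proof -
  have "measure \<mu> A = measure (distr \<mu> \<mu> (\<lambda>k. h ** k)) A"
    by (simp add: distr_mult_left[OF assms(1)])
  also have "\<dots> = measure \<mu> ((\<lambda>k. h ** k) -` A \<inter> space \<mu>)"
    by (rule measure_distr[OF measurable_mult_left[OF assms(1)] assms(2)])
  also have "(\<lambda>k. h ** k) -` A \<inter> space \<mu> = {k \<in> K. h ** k \<in> A}"
    by (auto simp: space_haar)
  finally show ?thesis by simp
qed

lemma continuous_matrix_transpose: "continuous_on S (transpose :: real^'n^'n \<Rightarrow> _)"
  by (intro linear_continuous_on)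
     (simp add: linear_conv_bounded_linear[symmetric] linear_iff vec_eq_iff transpose_def)

text \<open>Fubini for \<open>f (y\<^sup>-\<^sup>1 x)\<close>: the inner integral over \<open>x\<close> is the right-hand side, the one
  over \<open>y\<close> the left-hand side. This makes \<open>\<mu>\<close> right-invariant as well.\<close>

lemma integral_transpose:
  fixes f :: "real^'n^'n \<Rightarrow> complex"
  assumes f: "continuous_on K f"
  shows "(LINT k|\<mu>. f (transpose k)) = (LINT k|\<mu>. f k)"
proof -
  interpret P: pair_sigma_finite \<mu> \<mu> ..
  interpret PF: finite_measure "\<mu> \<Otimes>\<^sub>M \<mu>"
    by (intro finite_measure_pair_measure finite_measure_axioms)
  have fT: "continuous_on K (\<lambda>k. f (transpose k))"
    using transpose_mem by (intro continuous_on_compose2[OF f continuous_matrix_transpose]) auto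
  have id: "(\<lambda>k. k) \<in> borel_measurable \<mu>"
    by (intro measurable_haar continuous_intros)
  have cont: "continuous_on UNIV (\<lambda>x. transpose (snd x) ** fst x :: real^'n^'n)"
    unfolding matrix_matrix_mult_def transpose_def
    by (intro continuous_intros)
  have pair: "(\<lambda>x. (fst x, snd x)) \<in> borel_measurable (\<mu> \<Otimes>\<^sub>M \<mu>)"
    unfolding borel_prod[symmetric]
    by (intro measurable_Pair measurable_compose[OF measurable_fst id] measurable_compose[OF measurable_snd id])
  have "(\<lambda>x. transpose (snd x) ** fst x) \<in> borel_measurable (\<mu> \<Otimes>\<^sub>M \<mu>)"
    using measurable_compose[OF pair borel_measurable_continuous_onI[OF cont]] by simp
  then have "(\<lambda>x. transpose (snd x) ** fst x) \<in> measurable (\<mu> \<Otimes>\<^sub>M \<mu>) \<mu>"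
    by (intro measurable_into_haar) (auto simp: space_pair_measure space_haar mult_mem transpose_mem)
  from measurable_compose[OF this measurable_haar[OF f]]
  have meas: "(\<lambda>x. f (transpose (snd x) ** fst x)) \<in> borel_measurable (\<mu> \<Otimes>\<^sub>M \<mu>)" .
  have "bounded (f ` K)"
    by (intro compact_imp_bounded compact_continuous_image f compact)
  then obtain B where "\<And>k. k \<in> K \<Longrightarrow> norm (f k) \<le> B"
    by (auto simp: bounded_iff)
  then have int: "integrable (\<mu> \<Otimes>\<^sub>M \<mu>) (\<lambda>(x, y). f (transpose y ** x))"
    using meas by (intro PF.integrable_const_bound[where B = B])
      (auto simp: space_pair_measure space_haar case_prod_unfold mult_mem transpose_mem intro!: AE_I2)
  have "(LINT y|\<mu>. LINT x|\<mu>. f (transpose y ** x)) = (LINT y|\<mu>. LINT k|\<mu>. f k)"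
    by (intro Bochner_Integration.integral_cong refl integral_mult_left f transpose_mem) (simp add: space_haar)
  also have "\<dots> = (LINT k|\<mu>. f k)"
    by (simp add: space_haar measure_haar)
  finally have 1: "(LINT y|\<mu>. LINT x|\<mu>. f (transpose y ** x)) = (LINT k|\<mu>. f k)" .
  have "(LINT x|\<mu>. LINT y|\<mu>. f (transpose y ** x)) = (LINT x|\<mu>. LINT k|\<mu>. f (transpose k))"
  proof (rule Bochner_Integration.integral_cong[OF refl])
    fix x assume "x \<in> space \<mu>"
    then have "transpose x \<in> K"
      by (simp add: space_haar transpose_mem)
    from integral_mult_left[OF this fT]
    show "(LINT y|\<mu>. f (transpose y ** x)) = (LINT k|\<mu>. f (transpose k))"
      by (simp add: matrix_transpose_mul)
  qed
  also have "\<dots> = (LINT k|\<mu>. f (transpose k))"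
    by (simp add: space_haar measure_haar)
  finally show ?thesis
    using P.Fubini_integral[OF int] 1 by simp
qed

text \<open>Inversion turns right translations into left ones. Right invariance is the form needed
  for averages, since replacing \<open>z\<close> by \<open>h z\<close> in the mean of
  \<open>q (k z)\<close> translates \<open>k\<close> on the right.\<close>

lemma integral_mult_right:
  fixes f :: "real^'n^'n \<Rightarrow> complex"
  assumes h: "h \<in> K" and f: "continuous_on K f"
  shows "(LINT k|\<mu>. f (k ** h)) = (LINT k|\<mu>. f k)"
proof -
  have "continuous_on K (\<lambda>k. k ** h)"
    by (intro linear_continuous_on)
       (simp add: linear_conv_bounded_linear[symmetric] linear_iff vec_eq_iff
          matrix_matrix_mult_def sum.distrib distrib_right sum_distrib_left mult.assoc)
  then have fh: "continuous_on K (\<lambda>k. f (k ** h))"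
    using mult_mem[OF _ h] by (intro continuous_on_compose2[OF f]) auto
  have fT: "continuous_on K (\<lambda>k. f (transpose k))"
    using transpose_mem by (intro continuous_on_compose2[OF f continuous_matrix_transpose]) auto
  have "(LINT k|\<mu>. f (k ** h)) = (LINT k|\<mu>. f (transpose (transpose h ** k)))"
    using integral_transpose[OF fh] by (simp add: matrix_transpose_mul)
  also have "\<dots> = (LINT k|\<mu>. f k)"
    using integral_mult_left[OF transpose_mem[OF h] fT] integral_transpose[OF f] by simp
  finally show ?thesis .
qed

lemma continuous_orbit_map: "continuous_on S (\<lambda>k. complexify_mat k *v z)"
proof -
  have "continuous_on S (\<lambda>k. endo_apply (cendo k) z)"
    by (intro endo_apply.continuous_on continuous_intros linear_continuous_on bounded_linear_cendo)
  then show ?thesis by simp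
qed

lemma polyfun_orbit_continuous: "polyfun q \<Longrightarrow> continuous_on S (\<lambda>k. q (complexify_mat k *v z))"
  by (rule continuous_on_compose2[OF polyfun_continuous[of q UNIV] continuous_orbit_map]) auto

text \<open>Polynomials in \<open>z\<close> whose coefficients depend continuously on
  \<open>k\<close>: integration over \<open>k\<close> then acts on the coefficients alone and yields
  a polynomial in normal form.\<close>

inductive coeff_family :: "(real^'n^'n \<Rightarrow> complex^'n \<Rightarrow> complex) \<Rightarrow> bool" where
  monomial: "continuous_on K c \<Longrightarrow> coeff_family (\<lambda>k z. c k * (\<Prod>i\<in>UNIV. (z $ i) ^ \<alpha> i))"
| add: "coeff_family F \<Longrightarrow> coeff_family G \<Longrightarrow> coeff_family (\<lambda>k z. F k z + G k z)"

lemma coeff_family_monomial_mult: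
  assumes "continuous_on K c" "coeff_family G"
  shows "coeff_family (\<lambda>k z. (c k * (\<Prod>i\<in>UNIV. (z $ i) ^ \<alpha> i)) * G k z)"
  using assms(2)
proof induction
  case (monomial d \<beta>)
  have eq: "(c k * (\<Prod>i\<in>UNIV. (z $ i) ^ \<alpha> i)) * (d k * (\<Prod>i\<in>UNIV. (z $ i) ^ \<beta> i))
      = (c k * d k) * (\<Prod>i\<in>UNIV. (z $ i) ^ (\<alpha> i + \<beta> i))" for k and z :: "complex^'n"
    by (simp only: monomial_mult[symmetric] mult_ac)
  show ?case
    unfolding eq by (rule coeff_family.monomial[OF continuous_on_mult[OF assms(1) monomial]])
next
  case (add F G)
  from coeff_family.add[OF add.IH] show ?case
    by (simp add: distrib_left)
qed

lemma coeff_family_mult: "coeff_family F \<Longrightarrow> coeff_family G \<Longrightarrow> coeff_family (\<lambda>k z. F k z * G k z)"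
proof (induction rule: coeff_family.induct)
  case (monomial c \<alpha>)
  then show ?case by (rule coeff_family_monomial_mult)
next
  case (add F H)
  from coeff_family.add[OF add.IH[OF add.prems]] show ?case
    by (simp add: distrib_right)
qed

lemma coeff_family_constant: "continuous_on K c \<Longrightarrow> coeff_family (\<lambda>k z. c k)"
  using coeff_family.monomial[of c "\<lambda>_. 0"] by simp

lemma coeff_family_coord: "coeff_family (\<lambda>k z. z $ i)"
proof -
  have "(\<Prod>j\<in>UNIV. (z $ j) ^ (if j = i then 1 else 0)) = z $ i" for z :: "complex^'n"
    by (simp add: if_distrib cong: if_cong)
  then show ?thesis
    using coeff_family.monomial[of "\<lambda>_. 1" "\<lambda>j. if j = i then 1 else 0"] by simp
qed

lemma coeff_family_sum: "(\<And>j. j \<in> J \<Longrightarrow> coeff_family (F j)) \<Longrightarrow> coeff_family (\<lambda>k z. \<Sum>j\<in>J. F j k z)"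
  by (induction J rule: infinite_finite_induct) (auto intro: coeff_family_constant coeff_family.add)

lemma coeff_family_polyfun: "polyfun q \<Longrightarrow> coeff_family (\<lambda>k z. q (complexify_mat k *v z))"
proof (induction rule: polyfun.induct)
  case (coord i)
  have "coeff_family (\<lambda>k z. \<Sum>j\<in>UNIV. complex_of_real (k $ i $ j) * z $ j)"
    by (intro coeff_family_sum coeff_family_mult coeff_family_coord coeff_family_constant continuous_intros)
  then show ?case
    by (simp add: matrix_vector_mult_def complexify_mat_def)
qed (auto intro: coeff_family_constant coeff_family.add coeff_family_mult)

lemma coeff_family_integral:
  assumes "coeff_family F"
  shows "complex_polynomial (\<lambda>z. LINT k|\<mu>. F k z)" and "continuous_on K (\<lambda>k. F k z)"
  using assms
proof (induction arbitrary: z rule: coeff_family.induct)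
  case (monomial c \<alpha>)
  { case 1 show ?case
      using complex_polynomial_monomial[of "LINT k|\<mu>. c k" \<alpha>] by simp }
  { case 2 show ?case using monomial by (intro continuous_intros) }
next
  case (add F G)
  { case 1
    have "(LINT k|\<mu>. F k z + G k z) = (LINT k|\<mu>. F k z) + (LINT k|\<mu>. G k z)" for z
      by (intro Bochner_Integration.integral_add integrable_continuous add.IH)
    then show ?case
      using complex_polynomial_add[OF add.IH(1) add.IH(3)] by simp }
  { case 2 show ?case by (intro continuous_intros add.IH) }
qed

text \<open>The Reynolds operator of \<open>K\<close>: right invariance of \<open>\<mu>\<close>
  gives invariance under \<open>K\<close>, which extends to \<open>K\<^sub>C\<close> because the
  average is again a polynomial.\<close>

lemma average_invariant_polynomial:
  assumes q: "polyfun q"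
  shows "(\<lambda>z. LINT k|\<mu>. q (complexify_mat k *v z)) \<in> invariant_polynomials K\<^sub>C"
proof -
  let ?p = "\<lambda>z. LINT k|\<mu>. q (complexify_mat k *v z)"
  have p: "complex_polynomial ?p"
    by (rule coeff_family_integral(1)[OF coeff_family_polyfun[OF q]])
  have "?p (complexify_mat h *v z) = ?p z" if "h \<in> K" for h z
    using integral_mult_right[OF that polyfun_orbit_continuous[OF q], of z]
    by (simp add: complexify_mat_mult matrix_vector_mul_assoc)
  then have "?p (A *v z) = ?p z" if "A \<in> K\<^sub>C" for A z
    by (rule polyfun_complexification_invariant[OF complex_polynomial_polyfun[OF p] _ that])
  with p show ?thesis
    by (simp add: invariant_polynomials_def)
qed

lemma invariant_polynomial_average:
  assumes "p \<in> invariant_polynomials K\<^sub>C"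
  shows "(LINT k|\<mu>. p (complexify_mat k *v z)) = p z"
proof -
  have "(LINT k|\<mu>. p (complexify_mat k *v z)) = (LINT k|\<mu>. p z)"
    using assms complexify_mem_complexification
    by (intro Bochner_Integration.integral_cong) (auto simp: invariant_polynomials_def space_haar)
  then show ?thesis
    by (simp add: space_haar measure_haar)
qed

text \<open>The hub of the equivalence: the conditions are compared through this one, which involves
  only the compact group.\<close>

definition same_means :: "complex^'n \<Rightarrow> complex^'n \<Rightarrow> bool" where
  "same_means \<xi> \<xi>' \<longleftrightarrow> (\<forall>q. polyfun q \<longrightarrow>
     (LINT k|\<mu>. q (complexify_mat k *v \<xi>)) = (LINT k|\<mu>. q (complexify_mat k *v \<xi>')))"

lemma invariants_eq_iff_same_means:
  "(\<forall>p\<in>invariant_polynomials K\<^sub>C. p \<xi> = p \<xi>') \<longleftrightarrow> same_means \<xi> \<xi>'"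
proof
  assume "\<forall>p\<in>invariant_polynomials K\<^sub>C. p \<xi> = p \<xi>'"
  then show "same_means \<xi> \<xi>'"
    using average_invariant_polynomial by (fast intro: same_means_def[THEN iffD2])
next
  assume means: "same_means \<xi> \<xi>'"
  show "\<forall>p\<in>invariant_polynomials K\<^sub>C. p \<xi> = p \<xi>'"
  proof
    fix p assume p: "p \<in> invariant_polynomials K\<^sub>C"
    then have "polyfun p"
      by (simp add: invariant_polynomials_def complex_polynomial_polyfun)
    then show "p \<xi> = p \<xi>'"
      using means invariant_polynomial_average[OF p] by (auto simp: same_means_def)
  qed
qed

end

section \<open>Spherical functions\<close>

lemma norm_exp_minus_one_le: "norm (exp z - 1) \<le> norm z * exp (norm z)" for z :: complex
proof -
  have "norm (exp z - 1 - z) \<le> (exp (norm z) - 1) * norm z"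
    by (rule norm_exp_minus_one_minus_id)
  then have "norm (exp z - 1) \<le> (exp (norm z) - 1) * norm z + norm z"
    using norm_triangle_ineq[of "exp z - 1 - z" z] by simp
  then show ?thesis by (simp add: algebra_simps)
qed

lemma cmod_herm_le: "cmod (herm z w) \<le> norm z * norm w"
proof -
  have "cmod (herm z w) \<le> (\<Sum>i\<in>UNIV. cmod (z $ i) * cmod (w $ i))"
    unfolding herm_def by (rule order_trans[OF norm_sum]) (simp add: norm_mult)
  also have "\<dots> \<le> norm z * norm w"
    using L2_set_mult_ineq[of "\<lambda>i. cmod (z $ i)" "\<lambda>i. cmod (w $ i)" UNIV] by (simp add: norm_vec_def)
  finally show ?thesis .
qed

lemma polyfun_cbilin: "polyfun (cbilin w)"
  unfolding cbilin_def[abs_def] by (intro polyfun_sum polyfun.mult polyfun.const polyfun.coord)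

lemma polyfun_herm: "polyfun (\<lambda>z. herm z v)"
  unfolding herm_def by (intro polyfun_sum polyfun.mult polyfun.const polyfun.coord)

context haar_group
begin

lemma integral_limit:
  fixes s :: "nat \<Rightarrow> real^'n^'n \<Rightarrow> complex"
  assumes s: "\<And>N. continuous_on K (s N)"
    and lim: "\<And>k. k \<in> K \<Longrightarrow> (\<lambda>N. s N k) \<longlonglongrightarrow> g k"
    and bound: "\<And>N k. k \<in> K \<Longrightarrow> norm (s N k) \<le> B"
  shows "(\<lambda>N. LINT k|\<mu>. s N k) \<longlonglongrightarrow> (LINT k|\<mu>. g k)"
proof (rule integral_dominated_convergence[where w = "\<lambda>_. B"])
  show "g \<in> borel_measurable \<mu>"
    by (rule borel_measurable_LIMSEQ_metric[where f = s, OF measurable_haar[OF s]]) (simp add: lim space_haar)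
qed (auto intro!: AE_I2 measurable_haar s simp: lim bound space_haar)

text \<open>Equality of means passes from polynomials to bounded pointwise limits on the two orbits.
  It is applied to the exponential and to inverse powers of
  \<open>1 - r * \<zeta> z\<close>.\<close>

lemma same_means_limit:
  assumes means: "same_means \<xi> \<xi>'" and q: "\<And>N. polyfun (q N)"
    and lim: "\<And>k. k \<in> K \<Longrightarrow> (\<lambda>N. q N (complexify_mat k *v \<xi>)) \<longlonglongrightarrow> g (complexify_mat k *v \<xi>)"
    and bound: "\<And>N k. k \<in> K \<Longrightarrow> norm (q N (complexify_mat k *v \<xi>)) \<le> B"
    and lim': "\<And>k. k \<in> K \<Longrightarrow> (\<lambda>N. q N (complexify_mat k *v \<xi>')) \<longlonglongrightarrow> g (complexify_mat k *v \<xi>')"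
    and bound': "\<And>N k. k \<in> K \<Longrightarrow> norm (q N (complexify_mat k *v \<xi>')) \<le> B"
  shows "(LINT k|\<mu>. g (complexify_mat k *v \<xi>)) = (LINT k|\<mu>. g (complexify_mat k *v \<xi>'))"
proof (rule LIMSEQ_unique)
  show "(\<lambda>N. LINT k|\<mu>. q N (complexify_mat k *v \<xi>)) \<longlonglongrightarrow> (LINT k|\<mu>. g (complexify_mat k *v \<xi>))"
    by (rule integral_limit[OF polyfun_orbit_continuous[OF q] lim bound])
  have "(LINT k|\<mu>. q N (complexify_mat k *v \<xi>)) = (LINT k|\<mu>. q N (complexify_mat k *v \<xi>'))" for N
    using means q[of N] by (simp add: same_means_def)
  then show "(\<lambda>N. LINT k|\<mu>. q N (complexify_mat k *v \<xi>)) \<longlonglongrightarrow> (LINT k|\<mu>. g (complexify_mat k *v \<xi>'))"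
    using integral_limit[OF polyfun_orbit_continuous[OF q] lim' bound'] by simp
qed

lemma orbit_bounded:
  assumes "continuous_on K (f :: _ \<Rightarrow> complex)"
  obtains B where "B \<ge> 0" "\<And>k. k \<in> K \<Longrightarrow> norm (f k) \<le> B"
proof -
  have "bounded (f ` K)"
    by (intro compact_imp_bounded compact_continuous_image assms compact)
  then obtain B where "\<And>k. k \<in> K \<Longrightarrow> norm (f k) \<le> B"
    by (auto simp: bounded_iff)
  then have "max B 0 \<ge> 0" "\<And>k. k \<in> K \<Longrightarrow> norm (f k) \<le> max B 0"
    by (simp_all add: le_max_iff_disj)
  then show thesis by (rule that)
qed

lemma same_means_imp_spherical_eq:
  assumes means: "same_means \<xi> \<xi>'"
  shows "spherical_fun \<mu> \<xi> = spherical_fun \<mu> \<xi>'"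
proof
  fix x :: "real^'n"
  define l where "l = cbilin (complexify_vec x)"
  define q where "q N z = (\<Sum>j<N. inverse (fact j) * (\<i> * l z) ^ j)" for N z
  have l: "polyfun l"
    unfolding l_def by (rule polyfun_cbilin)
  have q: "polyfun (q N)" for N
    unfolding q_def[abs_def] by (intro polyfun_sum polyfun.mult polyfun.const polyfun_power l)
  have lim: "(\<lambda>N. q N z) \<longlonglongrightarrow> exp (\<i> * l z)" for z
    using exp_converges[of "\<i> * l z"] unfolding sums_def q_def by (simp add: scaleR_conv_of_real)
  have le: "norm (q N z) \<le> exp (norm (l z))" for N z
  proof -
    have "norm (q N z) \<le> (\<Sum>j<N. norm (l z) ^ j /\<^sub>R fact j)"
      unfolding q_def by (rule order_trans[OF norm_sum]) (simp add: norm_mult norm_power norm_inverse)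
    also have "\<dots> \<le> exp (norm (l z))"
      using sum_le_suminf[OF summable_exp_generic[of "norm (l z)"], of "{..<N}"] by (simp add: exp_def)
    finally show ?thesis .
  qed
  obtain B where B: "\<And>k. k \<in> K \<Longrightarrow> norm (l (complexify_mat k *v \<xi>)) \<le> B"
    using orbit_bounded[OF polyfun_orbit_continuous[OF l]] by metis
  obtain B' where B': "\<And>k. k \<in> K \<Longrightarrow> norm (l (complexify_mat k *v \<xi>')) \<le> B'"
    using orbit_bounded[OF polyfun_orbit_continuous[OF l]] by metis
  have "(LINT k|\<mu>. exp (\<i> * l (complexify_mat k *v \<xi>))) = (LINT k|\<mu>. exp (\<i> * l (complexify_mat k *v \<xi>')))"
  proof (rule same_means_limit[OF means q lim _ lim, where B = "exp (max B B')"])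
    show "norm (q N (complexify_mat k *v \<xi>)) \<le> exp (max B B')" if "k \<in> K" for N k
      using B[OF that] by (intro order_trans[OF le]) simp
    show "norm (q N (complexify_mat k *v \<xi>')) \<le> exp (max B B')" if "k \<in> K" for N k
      using B'[OF that] by (intro order_trans[OF le]) simp
  qed
  then show "spherical_fun \<mu> \<xi> x = spherical_fun \<mu> \<xi>' x"
    by (simp add: spherical_fun_def l_def)
qed

text \<open>For monomials \<open>g\<close> these are, up to powers of \<open>\<i>\<close>, the
  partial derivatives of the spherical function. At \<open>x = 0\<close> the exponential disappears
  and the mean of \<open>g\<close> remains.\<close>

definition twisted_mean :: "(complex^'n \<Rightarrow> complex) \<Rightarrow> real^'n \<Rightarrow> complex^'n \<Rightarrow> complex" where
  "twisted_mean g x \<xi> = (LINT k|\<mu>. g (complexify_mat k *v \<xi>) * exp (\<i> * cbilin (complexify_vec x) (complexify_mat k *v \<xi>)))"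

lemma twisted_continuous:
  "polyfun g \<Longrightarrow> continuous_on S (\<lambda>k. g (complexify_mat k *v \<xi>) * exp (\<i> * cbilin w (complexify_mat k *v \<xi>)))"
  by (intro continuous_intros polyfun_orbit_continuous polyfun_cbilin)

text \<open>Differentiation in \<open>x\<close> multiplies the integrand by a coordinate function.\<close>

lemma twisted_mean_coord:
  assumes g: "polyfun g"
  shows "(\<lambda>n. (twisted_mean g (x + (1 / real (Suc n)) *\<^sub>R axis i 1) \<xi> - twisted_mean g x \<xi>) / (1 / real (Suc n)))
    \<longlonglongrightarrow> \<i> * twisted_mean (\<lambda>z. z $ i * g z) x \<xi>"
proof -
  define t where "t n = 1 / real (Suc n)" for n
  have t: "t n > 0" "t n \<le> 1" for n by (simp_all add: t_def)
  have t0: "t \<longlonglongrightarrow> 0" unfolding t_def by (rule LIMSEQ_Suc[OF lim_1_over_n])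
  define z where "z k = complexify_mat k *v \<xi>" for k
  define F where "F y k = g (z k) * exp (\<i> * cbilin (complexify_vec y) (z k))" for y k
  define s where "s n k = (F (x + t n *\<^sub>R axis i 1) k - F x k) / t n" for n k
  have F: "continuous_on K (F y)" for y
    unfolding F_def[abs_def] z_def by (rule twisted_continuous[OF g])
  have seq: "s n k = F x k * ((exp (\<i> * z k $ i * t n) - 1) / t n)" for n k
  proof -
    have "complexify_vec (x + t n *\<^sub>R axis i 1) $ j * z k $ j
        = complexify_vec x $ j * z k $ j + (if j = i then t n * z k $ j else 0)" for j
      by (simp add: complexify_vec_def axis_def distrib_right)
    then have "cbilin (complexify_vec (x + t n *\<^sub>R axis i 1)) (z k) = cbilin (complexify_vec x) (z k) + t n * z k $ i"
      by (simp add: cbilin_def sum.distrib)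
    then have "F (x + t n *\<^sub>R axis i 1) k = F x k * exp (\<i> * z k $ i * t n)"
      by (simp add: F_def distrib_left exp_add mult_ac)
    then show ?thesis by (simp add: s_def right_diff_distrib)
  qed
  obtain B where B: "B \<ge> 0" "\<And>k. k \<in> K \<Longrightarrow> norm (F x k) \<le> B"
    using orbit_bounded[OF F] by metis
  have "(\<lambda>n. LINT k|\<mu>. s n k) \<longlonglongrightarrow> (LINT k|\<mu>. F x k * (\<i> * z k $ i))"
  proof (rule integral_limit)
    show "continuous_on K (s n)" for n
      unfolding s_def[abs_def] using t(1)[of n] by (intro continuous_intros F) auto
    show "(\<lambda>n. s n k) \<longlonglongrightarrow> F x k * (\<i> * z k $ i)" for k
    proof -
      have "((\<lambda>h. exp (\<i> * z k $ i * h)) has_field_derivative \<i> * z k $ i) (at 0)"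
        by (auto intro!: derivative_eq_intros)
      then have d: "((\<lambda>h. (exp (\<i> * z k $ i * h) - 1) / h) \<longlongrightarrow> \<i> * z k $ i) (at 0)"
        by (simp add: has_field_derivative_iff)
      have "(\<lambda>n. complex_of_real (t n)) \<longlonglongrightarrow> 0"
        using tendsto_of_real[OF t0] by simp
      then have "filterlim (\<lambda>n. complex_of_real (t n)) (at 0) sequentially"
        using t by (auto simp: filterlim_at intro!: always_eventually) (metis less_irrefl)
      from tendsto_mult_left[OF filterlim_compose[OF d this]]
      show ?thesis by (simp add: seq)
    qed
    \<comment> \<open>A bound uniform in \<open>n\<close>, as dominated convergence requires:
      \<open>k\<close> preserves length, so coordinates are at most \<open>norm \<xi>\<close>, and
      \<open>t n \<le> 1\<close> controls the exponential.\<close>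
    show "norm (s n k) \<le> B * (norm \<xi> * exp (norm \<xi>))" if k: "k \<in> K" for n k
    proof -
      have zi: "norm (z k $ i) \<le> norm \<xi>"
        using Finite_Cartesian_Product.norm_nth_le[of "z k" i] norm_complexify_orthogonal[OF orthogonal[OF k]]
        by (simp add: z_def)
      have "norm (exp (\<i> * z k $ i * t n) - 1) \<le> norm (\<i> * z k $ i * t n) * exp (norm (\<i> * z k $ i * t n))"
        by (rule norm_exp_minus_one_le)
      also have "\<dots> \<le> (norm \<xi> * t n) * exp (norm \<xi>)"
        using zi t[of n] mult_mono[OF zi t(2)[of n]]
        by (intro mult_mono) (auto simp: norm_mult)
      finally have "norm ((exp (\<i> * z k $ i * t n) - 1) / t n) \<le> norm \<xi> * exp (norm \<xi>)"
        using t(1)[of n] by (simp add: norm_divide field_simps)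
      then show ?thesis
        unfolding seq norm_mult using B k by (intro mult_mono) auto
    qed
  qed
  moreover have "(LINT k|\<mu>. s n k) = (twisted_mean g (x + t n *\<^sub>R axis i 1) \<xi> - twisted_mean g x \<xi>) / t n" for n
    unfolding s_def twisted_mean_def z_def[symmetric] F_def[symmetric]
    by (simp add: Bochner_Integration.integral_diff[OF integrable_continuous[OF F] integrable_continuous[OF F]])
  moreover have "(LINT k|\<mu>. F x k * (\<i> * z k $ i)) = \<i> * twisted_mean (\<lambda>z. z $ i * g z) x \<xi>"
    unfolding twisted_mean_def z_def[symmetric] F_def integral_mult_right_zero[symmetric]
    by (simp add: mult_ac)
  ultimately show ?thesis
    by (simp add: t_def)
qed

text \<open>Agreement is carried along for all \<open>x\<close>, because passing from
  \<open>g\<close> to \<open>z $ i * g\<close> compares difference quotients in \<open>x\<close>;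
  only at the end is \<open>x = 0\<close> inserted.\<close>

lemma spherical_eq_imp_same_means:
  assumes eq: "spherical_fun \<mu> \<xi> = spherical_fun \<mu> \<xi>'"
  shows "same_means \<xi> \<xi>'"
proof -
  define Q where "Q g \<longleftrightarrow> polyfun g \<and> (\<forall>x. twisted_mean g x \<xi> = twisted_mean g x \<xi>')" for g
  have Q1: "Q (\<lambda>_. 1)"
  proof -
    have "twisted_mean (\<lambda>_. 1) x \<xi> = spherical_fun \<mu> \<xi> x" for x \<xi>
      by (simp add: twisted_mean_def spherical_fun_def)
    then show ?thesis by (simp add: Q_def polyfun.const eq)
  qed
  have Qcoord: "Q (\<lambda>z. z $ i * g z)" if "Q g" for g i
  proof -
    have g: "polyfun g" and tw: "\<And>x. twisted_mean g x \<xi> = twisted_mean g x \<xi>'"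
      using that by (auto simp: Q_def)
    have "\<i> * twisted_mean (\<lambda>z. z $ i * g z) x \<xi> = \<i> * twisted_mean (\<lambda>z. z $ i * g z) x \<xi>'" for x
      using LIMSEQ_unique[OF twisted_mean_coord[OF g, of x i \<xi>, unfolded tw] twisted_mean_coord[OF g, of x i \<xi>']] .
    then show ?thesis
      using g by (simp add: Q_def polyfun.intros)
  qed
  have Qadd: "Q (\<lambda>z. f z + g z)" if "Q f" "Q g" for f g
  proof -
    have "twisted_mean (\<lambda>z. f z + g z) x \<eta> = twisted_mean f x \<eta> + twisted_mean g x \<eta>" for x \<eta>
      unfolding twisted_mean_def distrib_right using that
      by (intro Bochner_Integration.integral_add integrable_continuous twisted_continuous) (auto simp: Q_def)
    then show ?thesis
      using that by (simp add: Q_def polyfun.add)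
  qed
  \<comment> \<open>The arbitrary factor \<open>g\<close> makes the product case work, by reading
    \<open>p * q * g\<close> as \<open>p\<close> times \<open>q * g\<close>.\<close>
  have "Q (\<lambda>z. q z * g z)" if "polyfun q" "Q g" for q g
    using that
  proof (induction arbitrary: g rule: polyfun.induct)
    case (const c)
    have "twisted_mean (\<lambda>z. c * g z) x \<eta> = c * twisted_mean g x \<eta>" for x \<eta>
      by (simp add: twisted_mean_def mult.assoc)
    then show ?case
      using const by (simp add: Q_def polyfun.intros)
  next
    case (add p q)
    then show ?case by (simp add: distrib_right Qadd)
  next
    case (mult p q)
    then show ?case by (simp add: mult.assoc)
  qed (rule Qcoord)
  from this[OF _ Q1] have "Q q" if "polyfun q" for q
    using that by simp
  then have "twisted_mean q 0 \<xi> = twisted_mean q 0 \<xi>'" if "polyfun q" for q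
    using that by (simp add: Q_def)
  moreover have "twisted_mean q 0 \<eta> = (LINT k|\<mu>. q (complexify_mat k *v \<eta>))" for q \<eta>
    by (simp add: twisted_mean_def cbilin_def complexify_vec_def)
  ultimately show ?thesis
    by (simp add: same_means_def)
qed

end

section \<open>Separation of orbit closures\<close>

text \<open>Continuity at \<open>\<tau> = 0\<close>, where the value is 1. A number
  \<open>a * (1 + \<i> * \<tau>)\<close> with \<open>a > 0\<close> and small \<open>\<tau>\<close>
  thus has an inverse power with positive real part; \<open>\<epsilon>\<close> depends on
  \<open>m\<close>, so \<open>m\<close> is fixed before the neighbourhood of
  \<open>v\<close>.\<close>

lemma inverse_power_sector:
  obtains \<epsilon> where "\<epsilon> > 0"
    and "\<And>\<tau>. \<bar>\<tau>\<bar> \<le> \<epsilon> \<Longrightarrow> 1 / 2 \<le> Re (inverse ((1 + \<i> * of_real \<tau>) ^ m))"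
proof -
  let ?f = "\<lambda>\<tau>::real. Re (inverse ((1 + \<i> * of_real \<tau>) ^ m))"
  have "(?f \<longlongrightarrow> Re (inverse ((1 + \<i> * of_real 0) ^ m))) (at 0)"
    by (intro tendsto_intros) simp
  then have "\<forall>\<^sub>F \<tau> in at 0. 1 / 2 < ?f \<tau>"
    by (rule order_tendstoD(1)) simp
  then obtain d where d: "d > 0" "\<And>\<tau>. \<tau> \<noteq> 0 \<Longrightarrow> \<bar>\<tau>\<bar> < d \<Longrightarrow> 1 / 2 < ?f \<tau>"
    by (auto simp only: eventually_at dist_real_def diff_zero)
  have "1 / 2 \<le> ?f \<tau>" if "\<bar>\<tau>\<bar> \<le> d / 2" for \<tau>
  proof (cases "\<tau> = 0")
    case False
    with d(1) that show ?thesis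
      by (intro less_imp_le d(2)) auto
  qed simp
  with d(1) that[of "d / 2"] show thesis
    using half_gt_zero by blast
qed

section \<open>Measure near the stabilizer, comparison of the means, and conjugacy\<close>

context haar_group
begin

text \<open>Pigeonhole: among the cells of side proportional to \<open>\<rho>\<close> that cover the orbit of \<open>v\<close>, some
  cell contains \<open>k v\<close> for a set of \<open>k\<close> of measure at least \<open>c \<rho>^d\<close>; translate it to \<open>v\<close>.\<close>

lemma measure_near_stabilizer:
  obtains c where "c > 0"
    and "\<And>\<rho>. 0 < \<rho> \<Longrightarrow> \<rho> \<le> 1 \<Longrightarrow>
      c * \<rho> ^ DIM(complex^'n) \<le> measure \<mu> {k \<in> K. norm (complexify_mat k *v v - v) \<le> \<rho>}"
proof -
  define d where "d = DIM(complex^'n)"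
  have d: "d > 0" by (simp add: d_def)
  \<comment> \<open>The number of cells is at most
    \<open>((2 * norm v * d + 4) / \<rho>) ^ d\<close>: per axis \<open>2 * M + 1\<close> is at most
    \<open>2 * norm v / s + 3\<close>, and 3 is enlarged to \<open>4 / \<rho>\<close> by
    \<open>\<rho> \<le> 1\<close>.\<close>
  define c where "c = inverse (2 * norm v * d + 4) ^ d"
  have pos: "2 * norm v * real d + 4 > 0"
    by (intro add_nonneg_pos mult_nonneg_nonneg) auto
  then have c: "c > 0" by (simp add: c_def)
  have "c * \<rho> ^ d \<le> measure \<mu> {k \<in> K. norm (complexify_mat k *v v - v) \<le> \<rho>}" (is "_ \<le> measure \<mu> ?S")
    if \<rho>: "0 < \<rho>" "\<rho> \<le> 1" for \<rho>
  proof -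
    \<comment> \<open>Points of one cell differ by at most \<open>s\<close> in each of the
      \<open>d\<close> real coordinates, hence by at most \<open>\<rho>\<close> in norm.\<close>
    define s where "s = \<rho> / d"
    have s: "s > 0" using \<rho> d by (simp add: s_def)
    define f where "f b k = (complexify_mat k *v v) \<bullet> b / s" for b k
    have fcont: "continuous_on K (f b)" for b
      unfolding f_def[abs_def] using s by (intro continuous_intros continuous_orbit_map) auto
    have fmeas [measurable]: "f b \<in> borel_measurable \<mu>" for b
      by (rule measurable_haar[OF fcont])
    have nmeas [measurable]: "(\<lambda>k. norm (complexify_mat k *v v - v)) \<in> borel_measurable \<mu>"
      by (intro measurable_haar continuous_intros continuous_orbit_map)
    have Sm: "?S \<in> sets \<mu>"
    proof -
      have "{k \<in> space \<mu>. norm (complexify_mat k *v v - v) \<le> \<rho>} \<in> sets \<mu>"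
        by measurable
      then show ?thesis by (simp add: space_haar)
    qed
    define M where "M = \<lceil>norm v / s\<rceil>"
    have M0: "M \<ge> 0"
      using s by (simp add: M_def) (meson divide_nonneg_pos less_le_trans neg_less_0_iff_less norm_ge_zero zero_less_one)
    define T where "T = (Basis :: (complex^'n) set) \<rightarrow>\<^sub>E {- M .. M}"
    have T: "finite T" "card T = nat (2 * M + 1) ^ d"
      using M0 by (auto simp: T_def d_def finite_PiE card_PiE)
    define A where "A \<kappa> = {k \<in> space \<mu>. \<forall>b\<in>Basis. of_int (\<kappa> b) \<le> f b k \<and> f b k < of_int (\<kappa> b) + 1}"
      for \<kappa> :: "complex^'n \<Rightarrow> int"
    have Am: "A \<kappa> \<in> sets \<mu>" for \<kappa>
      unfolding A_def by measurable
    have cover: "K \<subseteq> (\<Union>\<kappa>\<in>T. A \<kappa>)"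
    proof
      fix k assume k: "k \<in> K"
      define \<kappa> where "\<kappa> = restrict (\<lambda>b. \<lfloor>f b k\<rfloor>) (Basis :: (complex^'n) set)"
      have "\<lfloor>f b k\<rfloor> \<in> {- M .. M}" if b: "b \<in> Basis" for b :: "complex^'n"
      proof -
        have "\<bar>(complexify_mat k *v v) \<bullet> b\<bar> \<le> norm v"
          using Basis_le_norm[OF b, of "complexify_mat k *v v"] norm_complexify_orthogonal[OF orthogonal[OF k]]
          by simp
        then have "\<bar>f b k\<bar> \<le> norm v / s"
          using s by (simp add: f_def divide_right_mono)
        also have "\<dots> \<le> of_int M"
          by (simp add: M_def)
        finally have "- of_int M \<le> f b k" "f b k \<le> of_int M"
          by auto
        then show ?thesis
          by (simp add: le_floor_iff floor_le_iff)
      qed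
      then have "\<kappa> \<in> T"
        by (auto simp: \<kappa>_def T_def)
      moreover have "k \<in> A \<kappa>"
        using k by (simp add: A_def \<kappa>_def space_haar)
      ultimately show "k \<in> (\<Union>\<kappa>\<in>T. A \<kappa>)" by blast
    qed
    have Ale: "measure \<mu> (A \<kappa>) \<le> measure \<mu> ?S" for \<kappa>
    proof (cases "A \<kappa> = {}")
      case False
      then obtain h where h: "h \<in> A \<kappa>" by blast
      then have hK: "h \<in> K" by (simp add: A_def space_haar)
      have "A \<kappa> \<subseteq> {k \<in> K. transpose h ** k \<in> ?S}"
      proof
        fix k assume k: "k \<in> A \<kappa>"
        then have kK: "k \<in> K" by (simp add: A_def space_haar)
        define w where "w = complexify_mat k *v v - complexify_mat h *v v"
        have "norm w \<le> (\<Sum>b\<in>Basis. \<bar>w \<bullet> b\<bar>)"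
          by (rule norm_le_l1)
        also have "\<dots> \<le> (\<Sum>b\<in>(Basis :: (complex^'n) set). s)"
        proof (rule sum_mono)
          fix b :: "complex^'n" assume "b \<in> Basis"
          then have "\<bar>f b k - f b h\<bar> \<le> 1"
            using h k unfolding A_def by force
          then show "\<bar>w \<bullet> b\<bar> \<le> s"
            using s by (simp add: f_def w_def inner_diff_left diff_divide_distrib[symmetric] abs_divide)
        qed
        also have "\<dots> = \<rho>"
          using d by (simp add: s_def d_def)
        finally have "norm w \<le> \<rho>" .
        moreover have "complexify_mat (transpose h ** k) *v v - v = complexify_mat (transpose h) *v w"
        proof -
          have "complexify_mat (transpose h) *v (complexify_mat h *v v) = v"
            by (simp add: matrix_vector_mul_assoc complexify_mat_mult[symmetric] transpose_mult[OF hK])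
          then show ?thesis
            by (simp add: w_def matrix_vector_mult_diff_distrib complexify_mat_mult matrix_vector_mul_assoc)
        qed
        ultimately show "k \<in> {k \<in> K. transpose h ** k \<in> ?S}"
          using kK mult_mem transpose_mem[OF hK] norm_complexify_orthogonal[OF orthogonal[OF transpose_mem[OF hK]], of w]
          by simp
      qed
      moreover have "{k \<in> K. transpose h ** k \<in> ?S} \<in> sets \<mu>"
        using measurable_sets[OF measurable_mult_left[OF transpose_mem[OF hK]] Sm]
        by (simp add: vimage_def Int_def conj_commute space_haar)
      ultimately have "measure \<mu> (A \<kappa>) \<le> measure \<mu> {k \<in> K. transpose h ** k \<in> ?S}"
        by (intro finite_measure_mono)
      also have "\<dots> = measure \<mu> ?S"
        by (rule measure_mult_left[OF transpose_mem[OF hK] Sm])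
      finally show ?thesis .
    qed simp
    have "1 \<le> measure \<mu> (\<Union>\<kappa>\<in>T. A \<kappa>)"
      unfolding measure_haar[symmetric] using cover Am T by (intro finite_measure_mono) auto
    also have "\<dots> \<le> (\<Sum>\<kappa>\<in>T. measure \<mu> (A \<kappa>))"
      using T Am by (intro finite_measure_subadditive_finite) auto
    also have "\<dots> \<le> (\<Sum>\<kappa>\<in>T. measure \<mu> ?S)"
      by (intro sum_mono Ale)
    also have "\<dots> = real (nat (2 * M + 1)) ^ d * measure \<mu> ?S"
      by (simp add: T)
    also have "\<dots> \<le> ((2 * norm v * d + 4) / \<rho>) ^ d * measure \<mu> ?S"
    proof (intro mult_right_mono power_mono)
      have "real_of_int M \<le> norm v / s + 1"
        by (simp add: M_def)
      then have "real (nat (2 * M + 1)) \<le> 2 * (norm v * d / \<rho>) + 3"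
        using M0 by (simp add: s_def)
      also have "\<dots> \<le> 2 * (norm v * d / \<rho>) + 4 / \<rho>"
        using \<rho> by (simp add: field_simps)
      finally show "real (nat (2 * M + 1)) \<le> (2 * norm v * d + 4) / \<rho>"
        by (simp add: add_divide_distrib)
    qed auto
    finally have "1 \<le> ((2 * norm v * d + 4) / \<rho>) ^ d * measure \<mu> ?S" .
    then have "c * \<rho> ^ d * 1 \<le> c * \<rho> ^ d * (((2 * norm v * d + 4) / \<rho>) ^ d * measure \<mu> ?S)"
      using c \<rho> by (intro mult_left_mono) auto
    also have "\<dots> = measure \<mu> ?S"
      using pos \<rho> by (simp add: c_def power_mult_distrib[symmetric] mult.assoc[symmetric])
    finally show ?thesis by simp
  qed
  with c that show thesis
    unfolding d_def by blast
qed

text \<open>If \<open>v\<close> is a zero of the moment map and no \<open>k v'\<close> equals \<open>v\<close>, then the means of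
  \<open>(1 - r * herm z v / |v|^2) ^ - m\<close> over \<open>K v'\<close> stay bounded as \<open>r\<close> tends to 1, whereas those
  over \<open>K v\<close> blow up for large \<open>m\<close>: near \<open>v\<close> the phase of the integrand is negligible.\<close>

lemma same_means_imp_conjugate:
  assumes means: "same_means v v'" and le: "norm v' \<le> norm v" and v0: "v \<noteq> 0"
    and moment: "\<And>X. X \<in> lie_algebra K \<Longrightarrow> inner (complexify_mat X *v v) (\<i> *s v) = 0"
  shows "\<exists>k\<in>K. complexify_mat k *v v' = v"
proof (rule ccontr)
  assume neq: "\<not> ?thesis"
  define R where "R = (norm v)\<^sup>2"
  have R: "R > 0" using v0 by (simp add: R_def)
  define \<zeta> where "\<zeta> z = herm z v / R" for z
  have \<zeta>poly: "polyfun \<zeta>"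
    unfolding \<zeta>_def[abs_def] divide_inverse by (intro polyfun.mult polyfun_herm polyfun.const)
  have \<zeta>le: "norm (\<zeta> z) \<le> 1" if "norm z \<le> norm v" for z
  proof -
    have "norm (herm z v) \<le> R"
      using cmod_herm_le[of z v] mult_right_mono[OF that, of "norm v"] by (simp add: R_def power2_eq_square)
    then show ?thesis
      using R by (simp add: \<zeta>_def norm_divide)
  qed
  have nv: "norm (complexify_mat k *v v) = norm v" if "k \<in> K" for k
    by (rule norm_complexify_orthogonal[OF orthogonal[OF that]])
  have nv': "norm (complexify_mat k *v v') \<le> norm v" if "k \<in> K" for k
    using norm_complexify_orthogonal[OF orthogonal[OF that], of v'] le by simp
  \<comment> \<open>Combined with the identity for \<open>norm (z - v)\<close> below:
    \<open>1 - Re (\<zeta> z)\<close> equals \<open>|z - v|^2 / (2 R)\<close> when \<open>z\<close>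
    is as long as \<open>v\<close>, and is at least that when \<open>z\<close> is shorter. The two
    cases serve \<open>K v\<close> and \<open>K v'\<close>.\<close>
  have Re\<zeta>: "1 - Re (\<zeta> z) = (2 * R - 2 * inner z v) / (2 * R)" for z
    using R by (simp add: \<zeta>_def Re_herm field_simps)
  have dist: "(norm (z - v))\<^sup>2 = (norm z)\<^sup>2 + R - 2 * inner z v" for z
    by (simp add: R_def power2_norm_eq_inner inner_diff_left inner_diff_right inner_commute)
  define g where "g m r z = inverse ((1 - of_real r * \<zeta> z) ^ m)" for m :: nat and r :: real and z
  have gmean: "(LINT k|\<mu>. g m r (complexify_mat k *v v)) = (LINT k|\<mu>. g m r (complexify_mat k *v v'))"
    if r: "0 \<le> r" "r < 1" for m r
  proof -
    \<comment> \<open>Powers of partial geometric sums: polynomials converging to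
      \<open>g m r\<close> and bounded by \<open>(1 / (1 - r)) ^ m\<close> on the ball of radius
      \<open>norm v\<close>, as long as \<open>r < 1\<close>.\<close>
    define q where "q N z = (\<Sum>j<N. (of_real r * \<zeta> z) ^ j) ^ m" for N z
    have q: "polyfun (q N)" for N
      unfolding q_def[abs_def]
      by (intro polyfun_power polyfun_sum polyfun.mult polyfun.const \<zeta>poly)
    have small: "norm (of_real r * \<zeta> z) \<le> r" if "norm z \<le> norm v" for z
      using mult_left_mono[OF \<zeta>le[OF that] r(1)] r(1) by (simp add: norm_mult)
    have lim: "(\<lambda>N. q N z) \<longlonglongrightarrow> g m r z" if "norm z \<le> norm v" for z
    proof -
      have "(\<lambda>j. (of_real r * \<zeta> z) ^ j) sums (1 / (1 - of_real r * \<zeta> z))"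
        using small[OF that] r by (intro geometric_sums) simp
      then have "(\<lambda>N. q N z) \<longlonglongrightarrow> (1 / (1 - of_real r * \<zeta> z)) ^ m"
        unfolding q_def sums_def by (rule tendsto_power)
      then show ?thesis
        by (simp add: g_def divide_inverse power_inverse)
    qed
    have bound: "norm (q N z) \<le> (1 / (1 - r)) ^ m" if "norm z \<le> norm v" for N z
    proof -
      have "norm (\<Sum>j<N. (of_real r * \<zeta> z) ^ j) \<le> (\<Sum>j<N. r ^ j)"
        by (intro order_trans[OF norm_sum] sum_mono) (simp only: norm_power, intro power_mono small that norm_ge_zero)
      also have "\<dots> \<le> (\<Sum>j. r ^ j)"
        using r by (intro sum_le_suminf summable_geometric) auto
      also have "\<dots> = 1 / (1 - r)"
        using r by (intro suminf_geometric) auto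
      finally show ?thesis
        unfolding q_def norm_power by (intro power_mono) auto
    qed
    show ?thesis
      by (rule same_means_limit[OF means q, where B = "(1 / (1 - r)) ^ m"])
         (auto intro: lim bound simp: nv nv')
  qed
  have nz: "1 - of_real r * \<zeta> z \<noteq> 0" if "norm z \<le> norm v" "0 \<le> r" "r < 1" for r z
  proof
    assume "1 - of_real r * \<zeta> z = 0"
    then have "norm (of_real r * \<zeta> z) = 1" by simp
    moreover have "norm (of_real r * \<zeta> z) \<le> r * 1"
      using mult_left_mono[OF \<zeta>le[OF that(1)] that(2)] that(2) by (simp add: norm_mult)
    ultimately show False using that by simp
  qed
  have gint: "integrable \<mu> (\<lambda>k. g m r (complexify_mat k *v w))"
    if "\<And>k. k \<in> K \<Longrightarrow> norm (complexify_mat k *v w) \<le> norm v" "0 \<le> r" "r < 1" for m r w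
    unfolding g_def using nz[OF that(1) that(2,3)]
    by (intro integrable_continuous continuous_intros polyfun_orbit_continuous \<zeta>poly) auto
  \<comment> \<open>By compactness \<open>K v'\<close> keeps a positive distance from
    \<open>v\<close>. The cap \<open>c \<le> 1\<close> makes \<open>c\<close> a lower bound for
    \<open>1 - r * Re (\<zeta> z)\<close> also where \<open>Re (\<zeta> z)\<close> is not
    positive.\<close>
  obtain c where c: "0 < c" "c \<le> 1" and cle: "\<And>k. k \<in> K \<Longrightarrow> c \<le> 1 - Re (\<zeta> (complexify_mat k *v v'))"
  proof -
    have "\<exists>k0\<in>K. \<forall>k\<in>K. norm (complexify_mat k0 *v v' - v) \<le> norm (complexify_mat k *v v' - v)"
      using one_mem by (intro continuous_attains_inf compact continuous_intros continuous_orbit_map) auto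
    then obtain k0 where k0: "k0 \<in> K" "\<And>k. k \<in> K \<Longrightarrow> norm (complexify_mat k0 *v v' - v) \<le> norm (complexify_mat k *v v' - v)"
      by blast
    define e where "e = norm (complexify_mat k0 *v v' - v)"
    have e: "e > 0" using neq k0(1) by (auto simp: e_def)
    have "min 1 (e\<^sup>2 / (2 * R)) \<le> 1 - Re (\<zeta> (complexify_mat k *v v'))" if k: "k \<in> K" for k
    proof -
      have "e\<^sup>2 \<le> (norm (complexify_mat k *v v' - v))\<^sup>2"
        using k0(2)[OF k] by (intro power_mono) (auto simp: e_def)
      also have "\<dots> \<le> 2 * R - 2 * inner (complexify_mat k *v v') v"
        using power_mono[OF nv'[OF k], of 2] by (simp add: dist R_def)
      finally have "e\<^sup>2 / (2 * R) \<le> 1 - Re (\<zeta> (complexify_mat k *v v'))"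
        unfolding Re\<zeta> using R by (intro divide_right_mono) auto
      then show ?thesis by simp
    qed
    then show thesis
      using that[of "min 1 (e\<^sup>2 / (2 * R))"] e R by simp
  qed
  have upper: "(LINT k|\<mu>. Re (g m r (complexify_mat k *v v))) \<le> inverse c ^ m" if r: "0 \<le> r" "r < 1" for m r
  proof -
    have "Re (g m r (complexify_mat k *v v')) \<le> inverse c ^ m" if k: "k \<in> K" for k
    proof -
      let ?z = "complexify_mat k *v v'"
      have "c \<le> 1 - r * Re (\<zeta> ?z)"
      proof (cases "Re (\<zeta> ?z) \<le> 0")
        case True
        then have "r * Re (\<zeta> ?z) \<le> 0"
          using r by (simp add: mult_nonneg_nonpos)
        then show ?thesis using c by linarith
      next
        case False
        then have "r * Re (\<zeta> ?z) \<le> 1 * Re (\<zeta> ?z)"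
          using r by (intro mult_right_mono) auto
        then show ?thesis using cle[OF k] by simp
      qed
      also have "\<dots> = Re (1 - of_real r * \<zeta> ?z)" by simp
      also have "\<dots> \<le> norm (1 - of_real r * \<zeta> ?z)" by (rule complex_Re_le_cmod)
      finally have "inverse (norm (1 - of_real r * \<zeta> ?z)) ^ m \<le> inverse c ^ m"
        using c by (intro power_mono le_imp_inverse_le) auto
      moreover have "Re (g m r ?z) \<le> inverse (norm (1 - of_real r * \<zeta> ?z)) ^ m"
        using complex_Re_le_cmod[of "g m r ?z"] by (simp add: g_def norm_inverse norm_power power_inverse)
      ultimately show ?thesis by linarith
    qed
    then have "(LINT k|\<mu>. Re (g m r (complexify_mat k *v v'))) \<le> (LINT k|\<mu>. inverse c ^ m)"
      using gint[OF nv' r] by (intro integral_mono) (auto simp: space_haar)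
    also have "\<dots> = inverse c ^ m"
      by (simp add: space_haar measure_haar)
    finally show ?thesis
      using arg_cong[OF gmean[OF r], of Re m] gint[OF nv' r, of m] gint[OF eq_refl[OF nv] r, of m]
      by (simp add: integral_Re)
  qed
  obtain C where C: "C > 0" "\<And>\<rho>. 0 < \<rho> \<Longrightarrow> \<rho> \<le> 1 \<Longrightarrow>
      C * \<rho> ^ DIM(complex^'n) \<le> measure \<mu> {k \<in> K. norm (complexify_mat k *v v - v) \<le> \<rho>}"
    by (rule measure_near_stabilizer[of v]) blast
  define d where "d = DIM(complex^'n)"
  \<comment> \<open>With \<open>h = 1 - r\<close>, the integrand is of order \<open>h ^ - m\<close>
    on a set of measure at least of order \<open>h ^ d\<close>; one exponent more than
    \<open>d\<close> makes the product grow like \<open>1 / h\<close>.\<close>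
  define m where "m = Suc d"
  obtain \<epsilon> where \<epsilon>: "\<epsilon> > 0" "\<And>\<tau>. \<bar>\<tau>\<bar> \<le> \<epsilon> \<Longrightarrow> 1 / 2 \<le> Re (inverse ((1 + \<i> * of_real \<tau>) ^ m))"
    by (rule inverse_power_sector) blast
  obtain \<delta> where \<delta>: "\<delta> > 0" and phase: "\<And>k. k \<in> K \<Longrightarrow> norm (complexify_mat k *v v - v) < \<delta> \<Longrightarrow>
      \<bar>Im (herm (complexify_mat k *v v) v)\<bar> \<le> \<epsilon> / 2 * (norm (complexify_mat k *v v - v))\<^sup>2"
    using imag_part_small[OF moment, of "\<epsilon> / 2"] \<epsilon> by auto
  \<comment> \<open>Outside the \<open>\<delta>\<close>-neighbourhood of \<open>v\<close> the
    quantity \<open>u\<close> below is at least \<open>\<eta>\<close>. As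
    \<open>r \<ge> 1 / 2\<close> will hold, the base then has real part at least
    \<open>\<eta> / 2\<close>, and \<open>B\<close> bounds the integrand.\<close>
  define \<eta> where "\<eta> = \<delta>\<^sup>2 / (2 * R)"
  have \<eta>: "\<eta> > 0" using \<delta> R by (simp add: \<eta>_def)
  define B where "B = (2 / \<eta>) ^ m"
  have B: "B \<ge> 0" using \<eta> by (simp add: B_def)
  have lower: "C * R ^ d / (4 * h) - B \<le> inverse c ^ m"
    if h: "0 < h" "h \<le> 1 / 2" "2 * R * h \<le> 1" "2 * R * h < \<delta>\<^sup>2" for h
  proof -
    define r where "r = 1 - h"
    have r: "1 / 2 \<le> r" "r < 1" using h by (auto simp: r_def)
    \<comment> \<open>The radius for which \<open>norm (k v - v) \<le> \<rho>\<close> means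
      \<open>u \<le> h\<close>, so that the real part \<open>a\<close> of the base is at most
      \<open>2 * h\<close> on \<open>S\<close>.\<close>
    define \<rho> where "\<rho> = sqrt (2 * R * h)"
    have \<rho>: "0 < \<rho>" "\<rho> \<le> 1" "\<rho>\<^sup>2 = 2 * R * h" using h R by (auto simp: \<rho>_def)
    have \<rho>\<delta>: "\<rho> < \<delta>"
      using power_less_imp_less_base[of \<rho> 2 \<delta>] \<rho> h \<delta> by simp
    define S where "S = {k \<in> K. norm (complexify_mat k *v v - v) \<le> \<rho>}"
    have Sm: "S \<in> sets \<mu>"
    proof -
      have [measurable]: "(\<lambda>k. norm (complexify_mat k *v v - v)) \<in> borel_measurable \<mu>"
        by (intro measurable_haar continuous_intros continuous_orbit_map)
      have "{k \<in> space \<mu>. norm (complexify_mat k *v v - v) \<le> \<rho>} \<in> sets \<mu>"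
        by measurable
      then show ?thesis by (simp add: S_def space_haar)
    qed
    \<comment> \<open>The term \<open>B\<close> pays for the points far from \<open>v\<close>, where
      the phase is uncontrolled. Near \<open>v\<close> but outside \<open>S\<close> positivity of
      the real part suffices.\<close>
    have pointwise: "1 / 2 * inverse (2 * h) ^ m * indicator S k - B \<le> Re (g m r (complexify_mat k *v v))"
      if k: "k \<in> K" for k
    proof -
      let ?z = "complexify_mat k *v v"
      define u where "u = (norm (?z - v))\<^sup>2 / (2 * R)"
      have u0: "u \<ge> 0" using R by (simp add: u_def)
      have u: "Re (\<zeta> ?z) = 1 - u"
      proof -
        have "u = 1 - Re (\<zeta> ?z)"
          unfolding Re\<zeta> u_def dist by (simp add: nv[OF k] R_def)
        then show ?thesis by simp
      qed
      define a where "a = 1 - r + r * u"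
      have a: "a > 0" "r * u \<le> a" using r u0 by (auto simp: a_def intro: add_pos_nonneg)
      have Rea: "Re (1 - of_real r * \<zeta> ?z) = a"
        by (simp add: u a_def algebra_simps)
      show ?thesis
      proof (cases "norm (?z - v) < \<delta>")
        case True
        \<comment> \<open>The base is \<open>a * (1 + \<i> * \<tau>)\<close>. The bound
          \<open>\<epsilon> / 2\<close> on the phase becomes
          \<open>\<bar>Im (\<zeta> z)\<bar> \<le> \<epsilon> * u\<close>, and
          \<open>r * u \<le> a\<close> makes \<open>\<tau>\<close> at most \<open>\<epsilon>\<close>
          uniformly in \<open>r\<close>.\<close>
        define \<tau> where "\<tau> = - (r * Im (\<zeta> ?z)) / a"
        have "\<bar>Im (\<zeta> ?z)\<bar> \<le> \<epsilon> * u"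
          using phase[OF k True] R by (simp add: \<zeta>_def u_def abs_divide field_simps)
        then have "r * \<bar>Im (\<zeta> ?z)\<bar> \<le> r * (\<epsilon> * u)"
          using r by (intro mult_left_mono) auto
        also have "\<dots> \<le> \<epsilon> * a"
          using mult_left_mono[OF a(2), of \<epsilon>] \<epsilon>(1) by (simp add: mult.left_commute)
        finally have "\<bar>\<tau>\<bar> \<le> \<epsilon>"
          using a r by (simp add: \<tau>_def abs_mult abs_divide pos_divide_le_eq)
        note \<tau> = \<epsilon>(2)[OF this]
        have "1 - of_real r * \<zeta> ?z = of_real a * (1 + \<i> * of_real \<tau>)"
          using Rea a by (simp add: complex_eq_iff \<tau>_def)
        then have "Re (g m r ?z) = inverse a ^ m * Re (inverse ((1 + \<i> * of_real \<tau>) ^ m))"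
          by (simp add: g_def power_mult_distrib power_inverse flip: of_real_power of_real_inverse)
        then have ge: "inverse a ^ m * (1 / 2) \<le> Re (g m r ?z)"
          using \<tau> a by (simp only:) (intro mult_left_mono, auto)
        show ?thesis
        proof (cases "k \<in> S")
          case True
          then have "(norm (?z - v))\<^sup>2 \<le> \<rho>\<^sup>2"
            by (intro power_mono) (auto simp: S_def)
          then have "u \<le> h"
            using R by (simp add: u_def \<rho> field_simps)
          then have "r * u \<le> 1 * h"
            using r u0 by (intro mult_mono) auto
          then have "a \<le> 2 * h"
            by (simp add: a_def r_def)
          then have "inverse (2 * h) ^ m \<le> inverse a ^ m"
            using a h by (intro power_mono le_imp_inverse_le) auto
          then show ?thesis
            using ge B True by simp
        next
          case False
          have "0 \<le> inverse a ^ m * (1 / 2)" using a by simp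
          then show ?thesis using ge B False by simp
        qed
      next
        case False
        then have "\<delta>\<^sup>2 \<le> (norm (?z - v))\<^sup>2"
          using \<delta> by (intro power_mono) auto
        then have "\<eta> \<le> u"
          using R by (simp add: \<eta>_def u_def divide_right_mono)
        then have "1 / 2 * \<eta> \<le> r * u"
          using r \<eta> by (intro mult_mono) auto
        then have "\<eta> / 2 \<le> norm (1 - of_real r * \<zeta> ?z)"
          using a(2) complex_Re_le_cmod[of "1 - of_real r * \<zeta> ?z"] Rea by simp
        then have "inverse (norm (1 - of_real r * \<zeta> ?z)) ^ m \<le> inverse (\<eta> / 2) ^ m"
          using \<eta> by (intro power_mono le_imp_inverse_le) auto
        then have "norm (g m r ?z) \<le> B"
          by (simp add: g_def B_def norm_inverse norm_power power_inverse)
        then have "- B \<le> Re (g m r ?z)"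
          using abs_Re_le_cmod[of "g m r ?z"] by linarith
        moreover have "k \<notin> S"
          using False \<rho>\<delta> by (auto simp: S_def)
        ultimately show ?thesis by simp
      qed
    qed
    have "1 / 2 * inverse (2 * h) ^ m * measure \<mu> S - B
        = (LINT k|\<mu>. 1 / 2 * inverse (2 * h) ^ m * indicator S k - B)"
      using Sm Int_absorb2[of S K]
      by (subst Bochner_Integration.integral_diff) (simp_all add: space_haar measure_haar emeasure_eq_measure S_def)
    also have "\<dots> \<le> (LINT k|\<mu>. Re (g m r (complexify_mat k *v v)))"
      using pointwise gint[OF eq_refl[OF nv], of r m] r Sm
      by (intro integral_mono) (auto simp: space_haar emeasure_eq_measure)
    also have "\<dots> \<le> inverse c ^ m"
      using r by (intro upper) auto
    finally have 1: "1 / 2 * inverse (2 * h) ^ m * measure \<mu> S - B \<le> inverse c ^ m" .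
    \<comment> \<open>Since \<open>\<rho> \<le> 1\<close>, the power \<open>\<rho> ^ d\<close> is
      weakened to \<open>\<rho> ^ (2 * d)\<close>, which is an integral power of
      \<open>h\<close>.\<close>
    have "C * (2 * R * h) ^ d \<le> C * \<rho> ^ d"
      unfolding \<rho>(3)[symmetric] using C(1) \<rho>(1,2)
      by (intro mult_left_mono power_mono) (auto simp: power2_eq_square mult_left_le)
    also have "\<dots> \<le> measure \<mu> S"
      unfolding S_def d_def by (rule C(2)[OF \<rho>(1,2)])
    finally have "1 / 2 * inverse (2 * h) ^ m * (C * (2 * R * h) ^ d) \<le> 1 / 2 * inverse (2 * h) ^ m * measure \<mu> S"
      using h by (intro mult_left_mono) auto
    moreover have "1 / 2 * inverse (2 * h) ^ m * (C * (2 * R * h) ^ d) = C * R ^ d / (4 * h)"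
      using h by (simp add: m_def field_simps power_mult_distrib)
    ultimately show ?thesis using 1 by linarith
  qed
  \<comment> \<open>For \<open>h \<le> G\<close> the growing term \<open>C * R ^ d / (4 * h)\<close>
    exceeds the bound \<open>inverse c ^ m + B\<close> by at least 1.\<close>
  define G where "G = C * R ^ d / (4 * (inverse c ^ m + B + 1))"
  have den: "inverse c ^ m + B + 1 > 0"
    using c B by (intro add_nonneg_pos add_nonneg_nonneg) auto
  have G: "G > 0"
    using C R den by (simp add: G_def)
  define h where "h = min (min (1 / 2) G) (min (1 / (2 * R)) (\<delta>\<^sup>2 / (4 * R)))"
  have h: "0 < h" "h \<le> 1 / 2" "h \<le> G" "h \<le> 1 / (2 * R)" "h \<le> \<delta>\<^sup>2 / (4 * R)"
    using G R \<delta> by (auto simp: h_def)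
  have "2 * R * h \<le> 1"
    using h(4) R by (simp add: field_simps)
  moreover have "2 * R * h < \<delta>\<^sup>2"
  proof -
    have "4 * R * h \<le> \<delta>\<^sup>2"
      using h(5) R by (simp add: field_simps)
    moreover have "0 < 2 * R * h"
      using R h by simp
    ultimately show ?thesis by linarith
  qed
  ultimately have "C * R ^ d / (4 * h) - B \<le> inverse c ^ m"
    by (intro lower h)
  moreover have "inverse c ^ m + B + 1 \<le> C * R ^ d / (4 * h)"
    using h(1,3) den by (simp add: G_def field_simps)
  ultimately show False by linarith
qed

lemma same_means_sym: "same_means \<xi> \<xi>' \<Longrightarrow> same_means \<xi>' \<xi>"
  by (simp add: same_means_def)

text \<open>Invariants are constant on orbit closures, so equality of means passes from
  \<open>\<xi>\<close>, \<open>\<xi>'\<close> to \<open>v\<close>, \<open>v'\<close>, and then some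
  \<open>k\<close> in \<open>K\<close> maps \<open>v'\<close> to \<open>v\<close>. The moment
  condition is asked only of the longer vector, which lets the two orbits exchange roles.\<close>

lemma closure_orbits_meet:
  assumes means: "same_means \<xi> \<xi>'" and v: "v \<in> closure (matrix_orbit K\<^sub>C \<xi>)"
    and v': "v' \<in> closure (matrix_orbit K\<^sub>C \<xi>')" and le: "norm v' \<le> norm v"
    and moment: "\<And>X. X \<in> lie_algebra K \<Longrightarrow> inner (complexify_mat X *v v) (\<i> *s v) = 0"
  shows "closure (matrix_orbit K\<^sub>C \<xi>) \<inter> closure (matrix_orbit K\<^sub>C \<xi>') \<noteq> {}"
proof (cases "v = 0")
  case True
  then have "v' = v" using le by simp
  with v v' show ?thesis by blast
next
  case False
  have "p v = p v'" if p: "p \<in> invariant_polynomials K\<^sub>C" for p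
  proof -
    have "polyfun p" "\<And>k z. k \<in> K \<Longrightarrow> p (complexify_mat k *v z) = p z"
      using p complexify_mem_complexification by (auto simp: invariant_polynomials_def complex_polynomial_polyfun)
    then have "p v = p \<xi>" "p v' = p \<xi>'"
      using polyfun_closure_orbit v v' by blast+
    moreover have "p \<xi> = p \<xi>'"
      using means p invariants_eq_iff_same_means by blast
    ultimately show ?thesis by simp
  qed
  then have "same_means v v'"
    using invariants_eq_iff_same_means by blast
  then obtain k where "k \<in> K" "complexify_mat k *v v' = v"
    using same_means_imp_conjugate[OF _ le False moment] by blast
  then have "v \<in> closure (matrix_orbit K\<^sub>C \<xi>')"
    using closure_orbit_mult[OF complexify_mult_complexification v'] by blast
  with v show ?thesis by blast
qed

lemma orbit_closures_meet_iff_same_means: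
  "closure (matrix_orbit K\<^sub>C \<xi>) \<inter> closure (matrix_orbit K\<^sub>C \<xi>') \<noteq> {} \<longleftrightarrow> same_means \<xi> \<xi>'"
proof
  assume "closure (matrix_orbit K\<^sub>C \<xi>) \<inter> closure (matrix_orbit K\<^sub>C \<xi>') \<noteq> {}"
  then obtain v where v: "v \<in> closure (matrix_orbit K\<^sub>C \<xi>)" "v \<in> closure (matrix_orbit K\<^sub>C \<xi>')"
    by blast
  have "p \<xi> = p \<xi>'" if p: "p \<in> invariant_polynomials K\<^sub>C" for p
  proof -
    have "polyfun p" "\<And>k z. k \<in> K \<Longrightarrow> p (complexify_mat k *v z) = p z"
      using p complexify_mem_complexification by (auto simp: invariant_polynomials_def complex_polynomial_polyfun)
    then have "p v = p \<xi>" "p v = p \<xi>'"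
      using polyfun_closure_orbit v by blast+
    then show ?thesis by simp
  qed
  then show "same_means \<xi> \<xi>'"
    using invariants_eq_iff_same_means by blast
next
  assume means: "same_means \<xi> \<xi>'"
  obtain v where v: "v \<in> closure (matrix_orbit K\<^sub>C \<xi>)"
    "\<And>X. X \<in> lie_algebra K \<Longrightarrow> inner (complexify_mat X *v v) (\<i> *s v) = 0"
    by (rule minimal_vector[of \<xi>]) blast
  obtain v' where v': "v' \<in> closure (matrix_orbit K\<^sub>C \<xi>')"
    "\<And>X. X \<in> lie_algebra K \<Longrightarrow> inner (complexify_mat X *v v') (\<i> *s v') = 0"
    by (rule minimal_vector[of \<xi>']) blast
  show "closure (matrix_orbit K\<^sub>C \<xi>) \<inter> closure (matrix_orbit K\<^sub>C \<xi>') \<noteq> {}"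
  proof (cases "norm v' \<le> norm v")
    case True
    then show ?thesis by (rule closure_orbits_meet[OF means v(1) v'(1) _ v(2)])
  next
    case False
    then show ?thesis
      using closure_orbits_meet[OF same_means_sym[OF means] v'(1) v(1) _ v'(2)] by (simp add: Int_commute)
  qed
qed

lemma spherical_eq_iff_same_means: "spherical_fun \<mu> \<xi> = spherical_fun \<mu> \<xi>' \<longleftrightarrow> same_means \<xi> \<xi>'"
  using same_means_imp_spherical_eq spherical_eq_imp_same_means by blast

end

section \<open>Points of the categorical quotient and the four conditions together\<close>

lemma quotient_projection_eq_iff:
  "quotient_projection H z = quotient_projection H w \<longleftrightarrow> (\<forall>p\<in>invariant_polynomials H. p z = p w)"
proof
  assume "quotient_projection H z = quotient_projection H w"
  moreover have "w \<in> quotient_projection H w"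
    by (simp add: quotient_projection_def quotient_rel_def)
  ultimately have "w \<in> quotient_projection H z" by simp
  then show "\<forall>p\<in>invariant_polynomials H. p z = p w"
    by (simp add: quotient_projection_def quotient_rel_def)
next
  assume eq: "\<forall>p\<in>invariant_polynomials H. p z = p w"
  have "(\<forall>p\<in>invariant_polynomials H. p z = p u) \<longleftrightarrow> (\<forall>p\<in>invariant_polynomials H. p w = p u)" for u
    using eq by metis
  then show "quotient_projection H z = quotient_projection H w"
    by (simp add: quotient_projection_def quotient_rel_def Image_singleton)
qed

theorem theorem4p2:
  fixes K :: "(real^'n^'n) set"
    and \<mu> :: "(real^'n^'n) measure"
    and \<xi> \<xi>' :: "complex^'n"
  assumes "subgroup K orthogonal_group"
    and "closed K"
    and "normalized_haar_measure K \<mu>"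
  shows "(spherical_fun \<mu> \<xi> = spherical_fun \<mu> \<xi>' \<longleftrightarrow>
            closure (matrix_orbit (complexification K) \<xi>) \<inter>
            closure (matrix_orbit (complexification K) \<xi>') \<noteq> {})
       \<and> (closure (matrix_orbit (complexification K) \<xi>) \<inter>
            closure (matrix_orbit (complexification K) \<xi>') \<noteq> {} \<longleftrightarrow>
            (\<forall>p\<in>invariant_polynomials (complexification K). p \<xi> = p \<xi>'))
       \<and> ((\<forall>p\<in>invariant_polynomials (complexification K). p \<xi> = p \<xi>') \<longleftrightarrow>
            quotient_projection (complexification K) \<xi> =
            quotient_projection (complexification K) \<xi>')"
proof -
  interpret haar_group K \<mu>
    using assms by (intro haar_group.intro closed_orthogonal_group.intro haar_group_axioms.intro)
  show ?thesis
    unfolding quotient_projection_eq_iff invariants_eq_iff_same_means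
      orbit_closures_meet_iff_same_means spherical_eq_iff_same_means
    by simp
qed

end
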